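(* Let $r\ge 2$ and $d\ge 3$ be integers. Let $0<\beta\le 1$ and $C>0$, and assume that the property $\mathcal G_r^{(d)}(\beta,C)$ holds. Let $t,m$ be positive integers, let $0<p\le 1$, and let $\delta,\lambda_0>0$. Set $$L=\log(1/\delta),\qquad L_p=\log(1/p),\qquad \rho=\log(r/\beta),$$ and suppose that $$0<\delta\le\min\{p/4,1/4\},\qquad \lambda_0\ge\max\{2,6L\},\qquad t\ge\lambda_0\,\delta^{-1/(d-1)}.$$ Define $$\Pi=\frac{3\delta}{p}+\frac{6LL_p}{\lambda_0},\qquad \Xi=2\rho+4C\lambda_0^{1/d}+\frac{12CL}{\lambda_0^{(d-1)/d}}.$$ Let $X,Y_1,\ldots,Y_r$ be nonempty vertex sets (not required to be disjoint) in a finite $r$-edge-colored complete graph. Suppose that $$|N_i(x)\cap Y_i|\ge p|Y_i|\quad (x\in X,\ i\in[r]),\qquad |Y_i|\ge p^{-t}e^{\Pi t}m\quad(i\in[r]),$$ and $$|X|\ge 2rt\,e^{rt\Xi}.$$ Then there exist an index $i\in[r]$, a color-$i$ clique $T\subseteq X$ with $|T|=t$, and a set $P\subseteq Y_i\setminus T$ with $|P|=m$ such that every edge between $T$ and $P$ has color $i$. In particular, $(T,P)$ is a color-$i$ $(t,m)$-book.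
   Context: $[r]=\{1,\dots,r\}$ and $\log$ is the natural logarithm. In an $r$-edge-colored complete graph with colors $1,\dots,r$, $N_i(v)=\{w: vw \text{ has color } i\}$ is the color-$i$ neighborhood of $v$ (graphs are simple, so $v\notin N_i(v)$). A color-$i$ clique is a vertex set all of whose internal edges have color $i$. A color-$i$ book is an ordered pair $(T,P)$ of disjoint vertex sets such that $T$ is a color-$i$ clique and every edge between $T$ and $P$ has color $i$; it is a $(t,m)$-book if $|T|=t$ and $|P|\ge m$. Property $\mathcal G_r^{(d)}(\beta,C)$ (for integers $r\ge2$, $d\ge3$ and reals $0<\beta\le1$, $C>0$): for every finite set $\mathcal X$, every pair $U,U'$ of independent copies of a random variable taking values in $\mathcal X$, and every collection of maps $\sigma_i:\mathcal X\to\mathcal H_i$ ($i\in[r]$) into real Hilbert spaces $\mathcal H_i$, setting $Z_i=\langle\sigma_i(U),\sigma_i(U')\rangle$, there exist $i\in[r]$ and a real $\lambda\ge-1$ such that $$\mathbb P\bigl(Z_i\ge\lambda,\ Z_j\ge-1\text{ for every }j\ne i\bigr)\ge\beta\exp\!\left(-C(\lambda+1)^{1/d}\right).$$ *)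

theory Defs
  imports "HOL-Probability.Probability"
begin

section \<open>Edge-coloured complete graphs\<close>

text \<open>The colour of the edge \<open>uv\<close> is \<open>c {u, v}\<close>; the values of \<open>c\<close> on sets that are not
  edges of the complete graph on \<open>V\<close> are irrelevant.\<close>

definition edge_coloured_complete_graph :: "'v set \<Rightarrow> nat \<Rightarrow> ('v set \<Rightarrow> nat) \<Rightarrow> bool" where
  "edge_coloured_complete_graph V r c \<longleftrightarrow>
     finite V \<and> (\<forall>u\<in>V. \<forall>v\<in>V. u \<noteq> v \<longrightarrow> c {u, v} \<in> {1..r})"

definition colour_nbhd :: "'v set \<Rightarrow> ('v set \<Rightarrow> nat) \<Rightarrow> nat \<Rightarrow> 'v \<Rightarrow> 'v set" where
  "colour_nbhd V c i v = {w \<in> V. w \<noteq> v \<and> c {v, w} = i}"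

definition colour_clique :: "'v set \<Rightarrow> ('v set \<Rightarrow> nat) \<Rightarrow> nat \<Rightarrow> 'v set \<Rightarrow> bool" where
  "colour_clique V c i T \<longleftrightarrow> T \<subseteq> V \<and> (\<forall>u\<in>T. \<forall>v\<in>T. u \<noteq> v \<longrightarrow> c {u, v} = i)"

definition colour_book :: "'v set \<Rightarrow> ('v set \<Rightarrow> nat) \<Rightarrow> nat \<Rightarrow> 'v set \<Rightarrow> 'v set \<Rightarrow> bool" where
  "colour_book V c i T P \<longleftrightarrow>
     colour_clique V c i T \<and> P \<subseteq> V \<and> T \<inter> P = {} \<and> (\<forall>u\<in>T. \<forall>w\<in>P. c {u, w} = i)"

definition colour_tm_book ::
    "'v set \<Rightarrow> ('v set \<Rightarrow> nat) \<Rightarrow> nat \<Rightarrow> nat \<Rightarrow> nat \<Rightarrow> 'v set \<Rightarrow> 'v set \<Rightarrow> bool" where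
  "colour_tm_book V c i t m T P \<longleftrightarrow> colour_book V c i T P \<and> card T = t \<and> card P \<ge> m"


section \<open>Real Hilbert spaces with an explicit carrier\<close>

text \<open>The class of all real Hilbert spaces has to be quantified over inside a hypothesis, which
  is not possible with the type classes \<open>real_inner\<close> and \<open>complete_space\<close>.\<close>

record 'h inner_struct =
  hcarrier :: "'h set"
  hadd :: "'h \<Rightarrow> 'h \<Rightarrow> 'h"
  hzero :: 'h
  hscale :: "real \<Rightarrow> 'h \<Rightarrow> 'h"
  hinner :: "'h \<Rightarrow> 'h \<Rightarrow> real"

definition hdist :: "'h inner_struct \<Rightarrow> 'h \<Rightarrow> 'h \<Rightarrow> real" where
  "hdist H x y =
     sqrt (hinner H (hadd H x (hscale H (-1) y)) (hadd H x (hscale H (-1) y)))"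

locale real_hilbert_space =
  fixes H :: "'h inner_struct"
  assumes zero_closed: "hzero H \<in> hcarrier H"
    and add_closed: "\<And>x y. x \<in> hcarrier H \<Longrightarrow> y \<in> hcarrier H \<Longrightarrow> hadd H x y \<in> hcarrier H"
    and scale_closed: "\<And>a x. x \<in> hcarrier H \<Longrightarrow> hscale H a x \<in> hcarrier H"
    and add_assoc: "\<And>x y z. x \<in> hcarrier H \<Longrightarrow> y \<in> hcarrier H \<Longrightarrow> z \<in> hcarrier H \<Longrightarrow>
          hadd H (hadd H x y) z = hadd H x (hadd H y z)"
    and add_commute: "\<And>x y. x \<in> hcarrier H \<Longrightarrow> y \<in> hcarrier H \<Longrightarrow> hadd H x y = hadd H y x"
    and add_zero: "\<And>x. x \<in> hcarrier H \<Longrightarrow> hadd H x (hzero H) = x"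
    and add_minus: "\<And>x. x \<in> hcarrier H \<Longrightarrow> hadd H x (hscale H (-1) x) = hzero H"
    and scale_one: "\<And>x. x \<in> hcarrier H \<Longrightarrow> hscale H 1 x = x"
    and scale_scale: "\<And>a b x. x \<in> hcarrier H \<Longrightarrow> hscale H a (hscale H b x) = hscale H (a * b) x"
    and scale_add_left: "\<And>a b x. x \<in> hcarrier H \<Longrightarrow>
          hscale H (a + b) x = hadd H (hscale H a x) (hscale H b x)"
    and scale_add_right: "\<And>a x y. x \<in> hcarrier H \<Longrightarrow> y \<in> hcarrier H \<Longrightarrow>
          hscale H a (hadd H x y) = hadd H (hscale H a x) (hscale H a y)"
    and inner_commute: "\<And>x y. x \<in> hcarrier H \<Longrightarrow> y \<in> hcarrier H \<Longrightarrow> hinner H x y = hinner H y x"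
    and inner_add: "\<And>x y z. x \<in> hcarrier H \<Longrightarrow> y \<in> hcarrier H \<Longrightarrow> z \<in> hcarrier H \<Longrightarrow>
          hinner H (hadd H x y) z = hinner H x z + hinner H y z"
    and inner_scale: "\<And>a x y. x \<in> hcarrier H \<Longrightarrow> y \<in> hcarrier H \<Longrightarrow>
          hinner H (hscale H a x) y = a * hinner H x y"
    and inner_nonneg: "\<And>x. x \<in> hcarrier H \<Longrightarrow> hinner H x x \<ge> 0"
    and inner_eq_zero: "\<And>x. x \<in> hcarrier H \<Longrightarrow> hinner H x x = 0 \<Longrightarrow> x = hzero H"
    and complete: "\<And>s :: nat \<Rightarrow> 'h. (\<And>n. s n \<in> hcarrier H) \<Longrightarrow>
          (\<And>e. e > 0 \<Longrightarrow> \<exists>N. \<forall>m\<ge>N. \<forall>n\<ge>N. hdist H (s m) (s n) < e) \<Longrightarrow>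
          \<exists>l\<in>hcarrier H. (\<lambda>n. hdist H (s n) l) \<longlonglongrightarrow> 0"

lemma real_hilbert_space_UNIV:
  "real_hilbert_space
     \<lparr>hcarrier = UNIV :: 'a :: {real_inner, complete_space} set, hadd = (+), hzero = 0,
      hscale = scaleR, hinner = inner\<rparr>" (is "real_hilbert_space ?H")
proof
  have d: "hdist ?H x y = dist x y" for x y
    unfolding hdist_def dist_norm norm_eq_sqrt_inner by simp
  fix s :: "nat \<Rightarrow> 'a"
  assume "\<And>e. e > 0 \<Longrightarrow> \<exists>N. \<forall>m\<ge>N. \<forall>n\<ge>N. hdist ?H (s m) (s n) < e"
  then have "Cauchy s" by (simp add: d Cauchy_def)
  then obtain l where "s \<longlonglongrightarrow> l" by (auto simp: Cauchy_convergent_iff convergent_def)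
  then show "\<exists>l\<in>hcarrier ?H. (\<lambda>n. hdist ?H (s n) l) \<longlonglongrightarrow> 0"
    by (intro bexI[of _ l]) (simp_all add: d flip: tendsto_dist_iff)
qed (simp_all add: add.assoc add.commute scaleR_left_distrib scaleR_right_distrib inner_add_left inner_add_right
    inner_commute)


section \<open>The geometric property\<close>

text \<open>HOL cannot quantify over types inside a formula, so the types of the sample spaces, of the
  elements of the finite set \<open>S\<close> and of the vectors are parameters here. \<open>geom_property\<close> fixes them
  to types that are rich enough: by the lemma \<open>geom_property_universal\<close> below it implies
  \<open>geom_property_on\<close> for all other types, so it is the property for all sample spaces, finite sets
  and Hilbert spaces.\<close>

definition geom_property_on ::
    "'w itself \<Rightarrow> 'x itself \<Rightarrow> 'h itself \<Rightarrow> nat \<Rightarrow> nat \<Rightarrow> real \<Rightarrow> real \<Rightarrow> bool" where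
  "geom_property_on W\<^sub>T X\<^sub>T H\<^sub>T r d \<beta> C \<longleftrightarrow>
     (\<forall>(S :: 'x set) (M :: 'w measure) (U :: 'w \<Rightarrow> 'x) (U' :: 'w \<Rightarrow> 'x)
       (H :: nat \<Rightarrow> 'h inner_struct) (\<sigma> :: nat \<Rightarrow> 'x \<Rightarrow> 'h).
        finite S \<longrightarrow>
        prob_space M \<longrightarrow>
        prob_space.indep_var M (count_space S) U (count_space S) U' \<longrightarrow>
        distr M (count_space S) U = distr M (count_space S) U' \<longrightarrow>
        (\<forall>i\<in>{1..r}. real_hilbert_space (H i) \<and> \<sigma> i \<in> S \<rightarrow> hcarrier (H i)) \<longrightarrow>
        (let Z = (\<lambda>i \<omega>. hinner (H i) (\<sigma> i (U \<omega>)) (\<sigma> i (U' \<omega>))) in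
         \<exists>i\<in>{1..r}. \<exists>lam\<ge>-1.
           measure M {\<omega> \<in> space M. Z i \<omega> \<ge> lam \<and> (\<forall>j\<in>{1..r} - {i}. Z j \<omega> \<ge> -1)}
             \<ge> \<beta> * exp (- C * (lam + 1) powr (1 / real d))))"

definition geom_property :: "nat \<Rightarrow> nat \<Rightarrow> real \<Rightarrow> real \<Rightarrow> bool" where
  "geom_property = geom_property_on TYPE(nat \<times> nat) TYPE(nat) TYPE(nat \<Rightarrow> real)"


subsection \<open>Independence of the choice of types\<close>

definition coord_space :: "nat \<Rightarrow> (nat \<Rightarrow> real) inner_struct" where
  "coord_space n = \<lparr>hcarrier = {f. \<forall>k\<ge>n. f k = 0}, hadd = (\<lambda>f g k. f k + g k),
     hzero = (\<lambda>k. 0), hscale = (\<lambda>a f k. a * f k), hinner = (\<lambda>f g. \<Sum>k<n. f k * g k)\<rparr>"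

lemma coord_space_simps [simp]:
  "hcarrier (coord_space n) = {f. \<forall>k\<ge>n. f k = 0}"
  "hadd (coord_space n) = (\<lambda>f g k. f k + g k)"
  "hzero (coord_space n) = (\<lambda>k. 0)"
  "hscale (coord_space n) = (\<lambda>a f k. a * f k)"
  "hinner (coord_space n) = (\<lambda>f g. \<Sum>k<n. f k * g k)"
  by (simp_all add: coord_space_def)

lemma hdist_coord_space: "hdist (coord_space n) f g = L2_set (\<lambda>k. f k - g k) {..<n}"
  by (simp add: hdist_def L2_set_def power2_eq_square)

lemma real_hilbert_space_coord_space: "real_hilbert_space (coord_space n)"
proof
  fix x assume x: "x \<in> hcarrier (coord_space n)" and "hinner (coord_space n) x x = 0"
  then have "\<forall>k<n. x k = 0" by (simp add: sum_nonneg_eq_0_iff)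
  with x have "x k = 0" for k by (cases "k < n") auto
  then show "x = hzero (coord_space n)" by auto
next
  fix s :: "nat \<Rightarrow> nat \<Rightarrow> real"
  assume s: "\<And>j. s j \<in> hcarrier (coord_space n)"
    and cau: "\<And>e. e > 0 \<Longrightarrow> \<exists>N. \<forall>m\<ge>N. \<forall>j\<ge>N. hdist (coord_space n) (s m) (s j) < e"
  have "\<exists>l. (\<lambda>j. s j k) \<longlonglongrightarrow> l" if "k < n" for k
  proof -
    have le: "\<bar>s m k - s j k\<bar> \<le> hdist (coord_space n) (s m) (s j)" for m j
      unfolding hdist_coord_space using that
      using member_le_L2_set[of "{..<n}" k "\<lambda>k. \<bar>s m k - s j k\<bar>"] by (simp add: L2_set_def)
    have "Cauchy (\<lambda>j. s j k)"
      unfolding Cauchy_def dist_real_def using cau le by (meson order.strict_trans1)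
    then show ?thesis by (simp add: Cauchy_convergent_iff convergent_def)
  qed
  then obtain l where l: "\<And>k. k < n \<Longrightarrow> (\<lambda>j. s j k) \<longlonglongrightarrow> l k" by metis
  define l' where "l' k = (if k < n then l k else 0)" for k
  have "(\<lambda>j. hdist (coord_space n) (s j) l') \<longlonglongrightarrow> L2_set (\<lambda>k. l' k - l' k) {..<n}"
    unfolding hdist_coord_space L2_set_def
    by (intro tendsto_intros) (auto simp: l'_def l)
  then show "\<exists>l\<in>hcarrier (coord_space n). (\<lambda>j. hdist (coord_space n) (s j) l) \<longlonglongrightarrow> 0"
    by (intro bexI[of _ l']) (auto simp: l'_def L2_set_def)
qed (auto simp: algebra_simps sum.distrib sum_distrib_left sum_nonneg)

context real_hilbert_space
begin

primrec lin_comb :: "(nat \<Rightarrow> real) \<Rightarrow> (nat \<Rightarrow> 'h) \<Rightarrow> nat \<Rightarrow> 'h" where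
  "lin_comb c v 0 = hzero H"
| "lin_comb c v (Suc n) = hadd H (lin_comb c v n) (hscale H (c n) (v n))"

lemma lin_comb_closed: "(\<And>k. k < n \<Longrightarrow> v k \<in> hcarrier H) \<Longrightarrow> lin_comb c v n \<in> hcarrier H"
  by (induction n) (auto simp: zero_closed add_closed scale_closed)

lemma inner_zero: "x \<in> hcarrier H \<Longrightarrow> hinner H (hzero H) x = 0"
  using inner_add[OF zero_closed zero_closed, of x] by (simp add: add_zero zero_closed)

lemma inner_lin_comb:
  "(\<And>k. k < n \<Longrightarrow> v k \<in> hcarrier H) \<Longrightarrow> w \<in> hcarrier H \<Longrightarrow>
     hinner H (lin_comb c v n) w = (\<Sum>k<n. c k * hinner H (v k) w)"
  by (induction n) (auto simp: inner_zero inner_add inner_scale lin_comb_closed scale_closed)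

lemma gram_nonneg:
  fixes c :: "nat \<Rightarrow> real" and v :: "nat \<Rightarrow> 'h"
  assumes v: "\<And>k. k < n \<Longrightarrow> v k \<in> hcarrier H"
  shows "0 \<le> (\<Sum>i<n. \<Sum>j<n. c i * c j * hinner H (v i) (v j))"
proof -
  let ?w = "lin_comb c v n"
  have w: "?w \<in> hcarrier H" using v by (rule lin_comb_closed)
  have "hinner H ?w ?w = (\<Sum>i<n. c i * hinner H (v i) ?w)"
    by (rule inner_lin_comb[OF v w])
  also have "\<dots> = (\<Sum>i<n. c i * hinner H ?w (v i))"
    using v w by (intro sum.cong) (auto simp: inner_commute)
  also have "\<dots> = (\<Sum>i<n. c i * (\<Sum>j<n. c j * hinner H (v j) (v i)))"
    using v by (intro sum.cong) (auto simp: inner_lin_comb)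
  also have "\<dots> = (\<Sum>i<n. \<Sum>j<n. c i * c j * hinner H (v i) (v j))"
    using v by (intro sum.cong) (auto simp: sum_distrib_left mult.assoc inner_commute intro!: sum.cong)
  finally show ?thesis using inner_nonneg[OF w] by simp
qed

end

lemma gram_factorisation:
  fixes G :: "nat \<Rightarrow> nat \<Rightarrow> real"
  assumes "\<And>i j. i < n \<Longrightarrow> j < n \<Longrightarrow> G i j = G j i"
    and "\<And>c. 0 \<le> (\<Sum>i<n. \<Sum>j<n. c i * c j * G i j)"
  shows "\<exists>v. (\<forall>i. \<forall>k\<ge>n. v i k = 0) \<and> (\<forall>i<n. \<forall>j<n. G i j = (\<Sum>k<n. v i k * v j k))"
  using assms
proof (induction n arbitrary: G)
  case 0
  show ?case by (rule exI[of _ "\<lambda>_ _. 0"]) auto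
next
  case (Suc n)
  note sym = Suc.prems(1)
  let ?g = "G n n"
  have expand: "(\<Sum>i<Suc n. \<Sum>j<Suc n. c i * c j * G i j) =
      (\<Sum>i<n. \<Sum>j<n. c i * c j * G i j) + 2 * c n * (\<Sum>i<n. c i * G i n) + (c n)\<^sup>2 * ?g" for c
  proof -
    have "(\<Sum>j<n. c n * c j * G n j) = c n * (\<Sum>i<n. c i * G i n)"
      unfolding sum_distrib_left by (intro sum.cong) (auto simp: sym[of n])
    moreover have "(\<Sum>i<n. c i * c n * G i n) = c n * (\<Sum>i<n. c i * G i n)"
      unfolding sum_distrib_left by (intro sum.cong) auto
    ultimately show ?thesis
      by (simp add: sum.distrib power2_eq_square)
  qed
  have psd: "0 \<le> (\<Sum>i<n. \<Sum>j<n. c i * c j * G i j) + 2 * a * (\<Sum>i<n. c i * G i n) + a\<^sup>2 * ?g"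
    for c a
    using Suc.prems(2)[of "c(n := a)"] unfolding expand by simp
  have g0: "?g \<ge> 0" using psd[of "\<lambda>_. 0" 1] by simp
  define G' where "G' i j = G i j - G i n * G j n / ?g" for i j
  have "0 \<le> (\<Sum>i<n. \<Sum>j<n. c i * c j * G' i j)" for c
  proof -
    let ?b = "\<Sum>i<n. c i * G i n"
    have "(\<Sum>i<n. \<Sum>j<n. c i * c j * G' i j) =
        (\<Sum>i<n. \<Sum>j<n. c i * c j * G i j) - ?b * ?b / ?g"
      by (simp add: G'_def sum_product sum_divide_distrib sum_subtractf algebra_simps)
    moreover have "0 \<le> (\<Sum>i<n. \<Sum>j<n. c i * c j * G i j) - ?b * ?b / ?g"
      using psd[of c "- ?b / ?g"] psd[of c 0]
      by (cases "?g = 0") (auto simp: power2_eq_square field_simps)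
    ultimately show ?thesis by simp
  qed
  moreover have "G' i j = G' j i" if "i < n" "j < n" for i j
    using that by (simp add: G'_def sym mult.commute)
  ultimately obtain v where v0: "\<And>i k. k \<ge> n \<Longrightarrow> v i k = 0"
    and v: "\<And>i j. i < n \<Longrightarrow> j < n \<Longrightarrow> G' i j = (\<Sum>k<n. v i k * v j k)"
    using Suc.IH[of G'] by blast
  have zero: "G i n = 0" if "?g = 0" "i < n" for i
  proof (rule ccontr)
    assume ne: "G i n \<noteq> 0"
    let ?e = "\<lambda>k. if k = i then 1 else (0::real)"
    have 1: "(\<Sum>k<n. ?e k * G k n) = G i n" using that by (simp add: if_distrib[of "\<lambda>x. x * _"] cong: if_cong)
    have "0 \<le> (\<Sum>k<n. \<Sum>j<n. ?e k * ?e j * G k j) + 2 * a * G i n" for a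
      using psd[of ?e a] unfolding 1 \<open>?g = 0\<close> by simp
    moreover define q where "q = (\<Sum>k<n. \<Sum>j<n. ?e k * ?e j * G k j)"
    ultimately have "0 \<le> q + 2 * a * G i n" for a by simp
    from this[of "- (q + 1) / (2 * G i n)"] ne have "0 \<le> q - (q + 1)"
      by (simp add: field_simps)
    then show False by simp
  qed
  define u where "u i k = (if i < n then if k < n then v i k else if k = n then G i n / sqrt ?g else 0
      else if k = n then sqrt ?g else 0)" for i k
  have "\<forall>i. \<forall>k\<ge>Suc n. u i k = 0" by (auto simp: u_def)
  moreover have "G i j = (\<Sum>k<Suc n. u i k * u j k)" if "i < Suc n" "j < Suc n" for i j
  proof -
    have s: "G i n / sqrt ?g * sqrt ?g = G i n" if "i < n" for i
      using g0 zero that by (cases "?g = 0") auto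
    consider "i < n" "j < n" | "i < n" "j = n" | "i = n" "j < n" | "i = n" "j = n"
      using \<open>i < Suc n\<close> \<open>j < Suc n\<close> by linarith
    then show ?thesis
    proof cases
      case 1
      then show ?thesis using v[OF 1] g0 by (simp add: u_def G'_def field_simps)
    next
      case 2
      then show ?thesis using s[of i] by (simp add: u_def)
    next
      case 3
      then show ?thesis using s[of j] sym[of n j] by (simp add: u_def mult.commute)
    next
      case 4
      then show ?thesis using g0 by (simp add: u_def)
    qed
  qed
  ultimately show ?case by blast
qed

lemma geom_property_universal:
  assumes "geom_property r d \<beta> C"
  shows "geom_property_on TYPE('w) TYPE('x) TYPE('h) r d \<beta> C"
  unfolding geom_property_on_def Let_def
proof (intro allI impI)
  fix S :: "'x set" and M :: "'w measure" and U U' :: "'w \<Rightarrow> 'x"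
    and H :: "nat \<Rightarrow> 'h inner_struct" and \<sigma> :: "nat \<Rightarrow> 'x \<Rightarrow> 'h"
  assume fin: "finite S" and M: "prob_space M"
    and ind: "prob_space.indep_var M (count_space S) U (count_space S) U'"
    and eqd: "distr M (count_space S) U = distr M (count_space S) U'"
    and H: "\<forall>i\<in>{1..r}. real_hilbert_space (H i) \<and> \<sigma> i \<in> S \<rightarrow> hcarrier (H i)"
  interpret M: prob_space M by (rule M)
  obtain e where e: "bij_betw e {..<card S} S"
    using ex_bij_betw_nat_finite[OF fin] by (auto simp: atLeast0LessThan)
  define n where "n = card S"
  define f where "f = the_inv_into {..<n} e"
  have fS: "f x < n" "e (f x) = x" if "x \<in> S" for x
    using e that bij_betw_apply[OF bij_betw_the_inv_into[OF e] that]
    by (auto simp: f_def n_def f_the_inv_into_f_bij_betw bij_betw_def)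
  let ?N = "count_space {..<n} :: nat measure"
  have UM [measurable]: "U \<in> measurable M (count_space S)" and U'M [measurable]: "U' \<in> measurable M (count_space S)"
    using ind unfolding M.indep_var_distribution_eq by auto
  have fm [measurable]: "f \<in> measurable (count_space S) ?N" using fS by auto
  have US: "U \<omega> \<in> S" "U' \<omega> \<in> S" if "\<omega> \<in> space M" for \<omega>
    using measurable_space[OF UM that] measurable_space[OF U'M that] by simp_all
  define Q where "Q = distr M (?N \<Otimes>\<^sub>M ?N) (\<lambda>\<omega>. (f (U \<omega>), f (U' \<omega>)))"
  have "prob_space Q" unfolding Q_def by (rule M.prob_space_distr) measurable
  then interpret Q: prob_space Q .
  have indf: "M.indep_var ?N (f \<circ> U) ?N (f \<circ> U')"
    by (rule M.indep_var_compose[OF ind]) (rule fm)+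
  have fstQ: "distr Q ?N fst = distr M ?N (f \<circ> U)" and sndQ: "distr Q ?N snd = distr M ?N (f \<circ> U')"
    unfolding Q_def by (subst distr_distr; simp add: comp_def)+
  have Qid: "distr Q (?N \<Otimes>\<^sub>M ?N) (\<lambda>x. (fst x, snd x)) = Q"
    unfolding Q_def by (subst distr_distr) (auto simp: comp_def)
  have indQ: "Q.indep_var ?N fst ?N snd"
    unfolding Q.indep_var_distribution_eq fstQ sndQ Qid
    using indf unfolding M.indep_var_distribution_eq by (auto simp: Q_def comp_def)
  have eqQ: "distr Q ?N fst = distr Q ?N snd"
  proof -
    have "distr M ?N (f \<circ> U) = distr (distr M (count_space S) U) ?N f"
      by (rule distr_distr[OF fm UM, symmetric])
    also have "\<dots> = distr M ?N (f \<circ> U')"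
      unfolding eqd by (rule distr_distr[OF fm U'M])
    finally show ?thesis unfolding fstQ sndQ .
  qed
  have eS: "e k \<in> S" if "k < n" for k using e that by (auto simp: n_def bij_betw_def)
  have "\<exists>v. (\<forall>k. \<forall>l\<ge>n. v k l = 0) \<and>
      (\<forall>k<n. \<forall>l<n. hinner (H i) (\<sigma> i (e k)) (\<sigma> i (e l)) = (\<Sum>a<n. v k a * v l a))"
    if "i \<in> {1..r}" for i
  proof -
    interpret Hi: real_hilbert_space "H i" using H that by auto
    have c: "\<sigma> i (e k) \<in> hcarrier (H i)" if "k < n" for k
      using H \<open>i \<in> {1..r}\<close> eS[OF that] by auto
    show ?thesis by (rule gram_factorisation) (auto intro!: Hi.gram_nonneg Hi.inner_commute c)
  qed
  then obtain v where v0: "\<And>i k l. i \<in> {1..r} \<Longrightarrow> l \<ge> n \<Longrightarrow> v i k l = 0"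
    and v: "\<And>i k l. i \<in> {1..r} \<Longrightarrow> k < n \<Longrightarrow> l < n \<Longrightarrow>
      hinner (H i) (\<sigma> i (e k)) (\<sigma> i (e l)) = (\<Sum>a<n. v i k a * v i l a)"
    by metis
  have Hv: "\<forall>i\<in>{1..r}. real_hilbert_space (coord_space n) \<and> v i \<in> {..<n} \<rightarrow> hcarrier (coord_space n)"
    using v0 by (auto intro: real_hilbert_space_coord_space)
  define E where "E i lam = {x \<in> {..<n} \<times> {..<n}. (\<Sum>a<n. v i (fst x) a * v i (snd x) a) \<ge> lam \<and>
      (\<forall>j\<in>{1..r} - {i}. (\<Sum>a<n. v j (fst x) a * v j (snd x) a) \<ge> -1)}" for i and lam :: real
  have spQ: "space Q = {..<n} \<times> {..<n}" by (simp add: Q_def space_pair_measure)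
  obtain i lam where i: "i \<in> {1..r}" "lam \<ge> -1"
    and le: "\<beta> * exp (- C * (lam + 1) powr (1 / real d)) \<le> measure Q (E i lam)"
    using assms[unfolded geom_property_def geom_property_on_def Let_def, rule_format,
        where H = "\<lambda>_. coord_space n" and \<sigma> = v,
        OF finite_lessThan \<open>prob_space Q\<close> indQ eqQ bspec[OF Hv]]
    unfolding E_def spQ by auto
  have "E i lam \<in> sets (?N \<Otimes>\<^sub>M ?N)"
    by (subst sets_pair_countable[of "{..<n}" "{..<n}"]) (auto simp: E_def)
  then have "measure Q (E i lam) = measure M ((\<lambda>\<omega>. (f (U \<omega>), f (U' \<omega>))) -` E i lam \<inter> space M)"
    unfolding Q_def by (subst measure_distr) auto
  also have "(\<lambda>\<omega>. (f (U \<omega>), f (U' \<omega>))) -` E i lam \<inter> space M =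
      {\<omega> \<in> space M. lam \<le> hinner (H i) (\<sigma> i (U \<omega>)) (\<sigma> i (U' \<omega>)) \<and>
        (\<forall>j\<in>{1..r} - {i}. -1 \<le> hinner (H j) (\<sigma> j (U \<omega>)) (\<sigma> j (U' \<omega>)))}"
  proof -
    have hj: "(\<Sum>a<n. v j (f (U \<omega>)) a * v j (f (U' \<omega>)) a) = hinner (H j) (\<sigma> j (U \<omega>)) (\<sigma> j (U' \<omega>))"
      if "\<omega> \<in> space M" "j \<in> {1..r}" for \<omega> j
      using v[OF that(2), of "f (U \<omega>)" "f (U' \<omega>)"] fS US[OF that(1)] by simp
    show ?thesis
    proof (rule set_eqI)
      fix \<omega>
      show "\<omega> \<in> (\<lambda>\<omega>. (f (U \<omega>), f (U' \<omega>))) -` E i lam \<inter> space M \<longleftrightarrow>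
        \<omega> \<in> {\<omega> \<in> space M. lam \<le> hinner (H i) (\<sigma> i (U \<omega>)) (\<sigma> i (U' \<omega>)) \<and>
          (\<forall>j\<in>{1..r} - {i}. -1 \<le> hinner (H j) (\<sigma> j (U \<omega>)) (\<sigma> j (U' \<omega>)))}"
      proof (cases "\<omega> \<in> space M")
        case True
        have "(\<forall>j\<in>{1..r} - {i}. -1 \<le> (\<Sum>a<n. v j (f (U \<omega>)) a * v j (f (U' \<omega>)) a)) \<longleftrightarrow>
            (\<forall>j\<in>{1..r} - {i}. -1 \<le> hinner (H j) (\<sigma> j (U \<omega>)) (\<sigma> j (U' \<omega>)))"
          using hj[OF True] by (intro ball_cong) auto
        then show ?thesis
          using True hj[OF True i(1)] fS(1)[OF US(1)[OF True]] fS(1)[OF US(2)[OF True]]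
          by (simp add: E_def)
      qed simp
    qed
  qed
  finally show "\<exists>i\<in>{1..r}. \<exists>lam\<ge>-1. \<beta> * exp (- C * (lam + 1) powr (1 / real d)) \<le>
      measure M {\<omega> \<in> space M. lam \<le> hinner (H i) (\<sigma> i (U \<omega>)) (\<sigma> i (U' \<omega>)) \<and>
        (\<forall>j\<in>{1..r} - {i}. -1 \<le> hinner (H j) (\<sigma> j (U \<omega>)) (\<sigma> j (U' \<omega>)))}"
    using le i by auto
qed

end

theory Submission
  imports Defs
begin

text \<open>
  The proof is a multicolour book algorithm. It keeps a reservoir \<open>X\<close>, monochromatic cliques \<open>T i\<close>
  and sets \<open>Y i\<close> such that all edges from \<open>T i\<close> to \<open>X\<close> and \<open>Y i\<close> have colour \<open>i\<close>. The geometric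
  property, applied to two independent uniform vertices of \<open>X\<close> and to centred indicators of their
  neighbourhoods in \<open>Y i\<close>, gives a vertex \<open>x\<close> and a subset of \<open>X\<close> on which passing from every \<open>Y i\<close> to
  the neighbourhood of \<open>x\<close> loses little density, while in one colour \<open>l\<close> the density rises by a
  multiple \<open>lam\<close> of the permitted loss. If \<open>lam \<le> lam0\<close>, then \<open>x\<close> joins the clique of its most
  popular colour; otherwise \<open>Y l\<close> alone is replaced, which is a density boost. The excess of the
  density of colour \<open>i\<close> over \<open>p - \<delta>\<close> is multiplied by \<open>1 - 1/t\<close> in a colour step and by
  \<open>1 + lam/t\<close> in a boost, starts at \<open>\<delta>\<close> and never exceeds 1, so the sum of \<open>ln (1 + lam/t)\<close> over all
  boosts in a colour is at most \<open>ln (1/\<delta>) + 2\<close>. This bounds the number of boosts and their total cost.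
\<close>

section \<open>The geometric property for uniformly random vertices\<close>

text \<open>The random pair is uniform on \<open>X \<times> X\<close>, so probabilities are counts
  of pairs. Averaging over the first coordinate fixes one \<open>x\<close> with at least the average
  number of partners \<open>y\<close>. Real functions on \<open>W\<close> serve as the
  vectors.\<close>

lemma geom_property_uniform:
  fixes X :: "'x set" and W :: "'v set" and f :: "nat \<Rightarrow> 'x \<Rightarrow> 'v \<Rightarrow> real"
  assumes geom: "geom_property r d \<beta> C"
    and X: "finite X" "X \<noteq> {}" and W: "finite W"
  defines "Z \<equiv> \<lambda>i x y. \<Sum>v\<in>W. f i x v * f i y v"
  obtains x i lam where "x \<in> X" "i \<in> {1..r}" "lam \<ge> -1"
    "\<beta> * exp (- C * (lam + 1) powr (1 / real d)) * card X
       \<le> card {y \<in> X. Z i x y \<ge> lam \<and> (\<forall>j\<in>{1..r} - {i}. Z j x y \<ge> -1)}"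
proof -
  let ?M = "uniform_count_measure (X \<times> X)"
  let ?N = "count_space X"
  have fin: "finite (X \<times> X)" and ne: "X \<times> X \<noteq> {}" using X by auto
  interpret M: prob_space ?M using fin ne by (rule prob_space_uniform_count_measure)
  have cX: "real (card X) > 0" using X by (simp add: card_gt_0_iff)
  \<comment> \<open>Counting rectangles yields both the independence and the equal distribution of
    the coordinate maps.\<close>
  have prod: "measure ?M (A \<times> B) = card A * card B / (card X)\<^sup>2"
    if "A \<subseteq> X" "B \<subseteq> X" for A B
    using fin that
    by (subst measure_uniform_count_measure) (auto simp: card_cartesian_product power2_eq_square)
  have pre: "fst -` A \<inter> space ?M = A \<times> X" "snd -` A \<inter> space ?M = X \<times> A" if "A \<subseteq> X" for A
    using that by (auto simp: space_uniform_count_measure)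
  have meas: "fst \<in> measurable ?M ?N" "snd \<in> measurable ?M ?N"
    by (auto simp: measurable_def space_uniform_count_measure sets_uniform_count_measure)
  have ind: "M.indep_var ?N fst ?N snd"
    unfolding M.indep_var_eq
  proof (intro conjI meas M.indep_set_sigma_sets)
    show "M.indep_set {fst -` A \<inter> space ?M |A. A \<in> sets ?N} {snd -` A \<inter> space ?M |A. A \<in> sets ?N}"
    proof (rule M.indep_setI)
      fix a b assume "a \<in> {fst -` A \<inter> space ?M |A. A \<in> sets ?N}" "b \<in> {snd -` A \<inter> space ?M |A. A \<in> sets ?N}"
      then obtain A B where AB: "A \<subseteq> X" "B \<subseteq> X" "a = A \<times> X" "b = X \<times> B"
        using pre by auto
      then have "a \<inter> b = A \<times> B" by auto
      then show "M.prob (a \<inter> b) = M.prob a * M.prob b"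
        unfolding AB(3,4) using AB(1,2) cX by (simp add: prod power2_eq_square)
    qed (use meas measurable_sets in blast)+
    show "Int_stable {fst -` A \<inter> space ?M |A. A \<in> sets ?N}"
      "Int_stable {snd -` A \<inter> space ?M |A. A \<in> sets ?N}"
      by (auto simp: Int_stable_def intro: exI[of _ "_ \<inter> _"])
  qed
  have eqd: "distr ?M ?N fst = distr ?M ?N snd"
  proof (rule measure_eqI)
    fix A assume "A \<in> sets (distr ?M ?N fst)"
    then have A: "A \<subseteq> X" "A \<in> sets ?N" by simp_all
    then show "emeasure (distr ?M ?N fst) A = emeasure (distr ?M ?N snd) A"
      by (simp only: emeasure_distr[OF meas(1) A(2)] emeasure_distr[OF meas(2) A(2)] pre[OF A(1)]
          M.emeasure_eq_measure prod order.refl mult.commute)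
  qed simp
  define n where "n = card W"
  obtain e where e: "bij_betw e {..<n} W"
    using ex_bij_betw_nat_finite[OF W] by (auto simp: atLeast0LessThan n_def)
  \<comment> \<open>The value 0 from index \<open>n\<close> on puts these vectors into the carrier
    of \<open>coord_space n\<close>.\<close>
  define w where "w i x k = (if k < n then f i x (e k) else 0)" for i x k
  have Zw: "(\<Sum>k<n. w i x k * w i y k) = Z i x y" for i x y
    unfolding Z_def sum.reindex_bij_betw[OF e, symmetric] by (rule sum.cong) (auto simp: w_def)
  have w: "\<forall>i\<in>{1..r}. real_hilbert_space (coord_space n) \<and> w i \<in> X \<rightarrow> hcarrier (coord_space n)"
    by (auto simp: w_def real_hilbert_space_coord_space)
  define E where "E i lam = {q \<in> X \<times> X. Z i (fst q) (snd q) \<ge> lam \<and>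
      (\<forall>j\<in>{1..r} - {i}. Z j (fst q) (snd q) \<ge> -1)}" for i lam
  have "\<exists>i\<in>{1..r}. \<exists>lam\<ge>-1. \<beta> * exp (- C * (lam + 1) powr (1 / real d)) \<le>
      measure ?M {q \<in> space ?M. hinner (coord_space n) (w i (fst q)) (w i (snd q)) \<ge> lam \<and>
        (\<forall>j\<in>{1..r} - {i}. hinner (coord_space n) (w j (fst q)) (w j (snd q)) \<ge> -1)}"
    by (rule geom_property_universal[OF geom, unfolded geom_property_on_def Let_def, rule_format,
        where H = "\<lambda>_. coord_space n" and \<sigma> = w and S = X and M = ?M,
        OF X(1) M.prob_space_axioms ind eqd bspec[OF w]])
  then have "\<exists>i\<in>{1..r}. \<exists>lam\<ge>-1.
      \<beta> * exp (- C * (lam + 1) powr (1 / real d)) \<le> measure ?M (E i lam)"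
    unfolding E_def coord_space_simps Zw space_uniform_count_measure .
  then obtain i lam where i: "i \<in> {1..r}" "lam \<ge> -1"
    and le: "\<beta> * exp (- C * (lam + 1) powr (1 / real d)) \<le> measure ?M (E i lam)"
    by blast
  define F where "F x = {y \<in> X. Z i x y \<ge> lam \<and> (\<forall>j\<in>{1..r} - {i}. Z j x y \<ge> -1)}" for x
  let ?g = "\<beta> * exp (- C * (lam + 1) powr (1 / real d))"
  have "\<exists>x\<in>X. ?g * card X \<le> card (F x)"
  proof (rule ccontr)
    assume "\<not> ?thesis"
    then have "(\<Sum>x\<in>X. real (card (F x))) < (\<Sum>x\<in>X. ?g * card X)"
      using X by (intro sum_strict_mono) auto
    moreover have "E i lam = Sigma X F" by (simp add: set_eq_iff E_def F_def conj_assoc)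
    then have "measure ?M (E i lam) = (\<Sum>x\<in>X. real (card (F x))) / (card X)\<^sup>2"
      using fin X by (subst measure_uniform_count_measure)
        (auto simp: card_SigmaI card_cartesian_product power2_eq_square F_def)
    ultimately show False
      using mult_right_mono[OF le, of "(real (card X))\<^sup>2"] cX
      by (simp add: power2_eq_square mult_ac)
  qed
  with i show ?thesis using that unfolding F_def by blast
qed

text \<open>Each of the two cross terms contributes \<open>- q * a\<close>, and
  \<open>q * card B = a\<close> turns the constant term \<open>q * q * card B\<close> into
  \<open>q * a\<close>, so a single \<open>- q * a\<close> survives.\<close>

lemma sum_centred_indicator:
  fixes q k :: real
  assumes W: "finite W" and B: "B \<subseteq> W" and A: "A \<subseteq> B" "card A = a" and A': "A' \<subseteq> B" "card A' = a"
    and q: "q * card B = a"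
  shows "(\<Sum>v\<in>W. ((indicator A v - q * indicator B v) * k) * ((indicator A' v - q * indicator B v) * k))
      = (card (A \<inter> A') - q * a) * k\<^sup>2"
proof -
  have card: "(\<Sum>v\<in>W. indicator D v) = real (card D)" if "D \<subseteq> W" for D
    using that W by (simp add: indicator_def sum.If_cases Int_absorb1)
  have "((indicator A v - q * indicator B v) * k) * ((indicator A' v - q * indicator B v) * k)
      = k\<^sup>2 * indicator (A \<inter> A') v - k\<^sup>2 * q * indicator A v - k\<^sup>2 * q * indicator A' v
         + k\<^sup>2 * q * q * indicator B v" for v
    using A A' by (auto simp: indicator_def algebra_simps power2_eq_square)
  then have "(\<Sum>v\<in>W. ((indicator A v - q * indicator B v) * k) * ((indicator A' v - q * indicator B v) * k))
      = k\<^sup>2 * card (A \<inter> A') - k\<^sup>2 * q * a - k\<^sup>2 * q * a + k\<^sup>2 * q * q * card B"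
    using card[of "A \<inter> A'"] card[of A] card[of A'] card[OF B] A A' B
    by (simp add: sum.distrib sum_subtractf flip: sum_distrib_left) (auto simp: algebra_simps)
  also have "\<dots> = (card (A \<inter> A') - q * a) * k\<^sup>2"
    by (simp add: mult.assoc q) (simp add: algebra_simps)
  finally show ?thesis .
qed

text \<open>The neighbourhoods are trimmed to subsets \<open>A i x\<close> of common size \<open>n i\<close>; then the inner
  product of the centred indicators of \<open>A i x\<close> and \<open>A i y\<close>, divided by \<open>\<alpha> i * n i\<close>, measures exactly
  by how many multiples of \<open>\<alpha> i\<close> the density of \<open>A i y\<close> in \<open>A i x\<close> differs from \<open>n i / card (Y i)\<close>.\<close>

lemma book_step:
  fixes N :: "nat \<Rightarrow> 'x \<Rightarrow> 'v set"
  assumes geom: "geom_property r d \<beta> C"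
    and X: "finite X" "X \<noteq> {}"
    and Y: "\<And>i. i \<in> {1..r} \<Longrightarrow> finite (Y i)"
    and n: "\<And>i. i \<in> {1..r} \<Longrightarrow> 0 < n i"
    and N: "\<And>i x. i \<in> {1..r} \<Longrightarrow> x \<in> X \<Longrightarrow> n i \<le> card (N i x \<inter> Y i)"
    and \<alpha>: "\<And>i. i \<in> {1..r} \<Longrightarrow> \<alpha> i > 0"
  obtains x X' Y' l lam where "x \<in> X" "X' \<subseteq> X" "l \<in> {1..r}" "lam \<ge> -1"
    "card X' \<ge> \<beta> * exp (- C * (lam + 1) powr (1 / real d)) * card X"
    "\<And>i. i \<in> {1..r} \<Longrightarrow> Y' i \<subseteq> N i x \<inter> Y i" "\<And>i. i \<in> {1..r} \<Longrightarrow> card (Y' i) = n i"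
    "\<And>y. y \<in> X' \<Longrightarrow> (n l / card (Y l) + lam * \<alpha> l) * n l \<le> card (N l y \<inter> Y' l)"
    "\<And>i y. i \<in> {1..r} \<Longrightarrow> y \<in> X' \<Longrightarrow> (n i / card (Y i) - \<alpha> i) * n i \<le> card (N i y \<inter> Y' i)"
proof -
  have "\<exists>A. A \<subseteq> N i x \<inter> Y i \<and> card A = n i" if "i \<in> {1..r}" "x \<in> X" for i x
    using obtain_subset_with_card_n[OF N[OF that]] by metis
  then obtain A where A: "\<And>i x. i \<in> {1..r} \<Longrightarrow> x \<in> X \<Longrightarrow> A i x \<subseteq> N i x \<inter> Y i"
    "\<And>i x. i \<in> {1..r} \<Longrightarrow> x \<in> X \<Longrightarrow> card (A i x) = n i"
    by metis
  define W where "W = (\<Union>i\<in>{1..r}. Y i)"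
  have W: "finite W" using Y by (auto simp: W_def)
  define q where "q i = real (n i) / card (Y i)" for i
  define f where "f i x v = (indicator (A i x) v - q i * indicator (Y i) v) * (1 / sqrt (\<alpha> i * n i))"
    for i x v
  have Z: "(\<Sum>v\<in>W. f i x v * f i y v) = (card (A i x \<inter> A i y) - q i * n i) / (\<alpha> i * n i)"
    if "i \<in> {1..r}" "x \<in> X" "y \<in> X" for i x y
  proof -
    have "card (Y i) \<noteq> 0"
      using N[OF that(1,2)] n[OF that(1)] Y[OF that(1)] by (auto simp: card_eq_0_iff)
    then have "q i * card (Y i) = n i" by (simp add: q_def)
    moreover have "Y i \<subseteq> W" using that by (auto simp: W_def)
    moreover have "A i x \<subseteq> Y i" "A i y \<subseteq> Y i" using A(1) that by blast+
    moreover have "0 \<le> \<alpha> i * n i" using n \<alpha> that by (simp add: less_imp_le)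
    ultimately show ?thesis
      using sum_centred_indicator[OF W, of "Y i" "A i x" "n i" "A i y" "q i" "1 / sqrt (\<alpha> i * n i)"] A(2) that
      by (simp add: f_def power_divide)
  qed
  obtain x l lam where x: "x \<in> X" and l: "l \<in> {1..r}" "lam \<ge> -1"
    and card: "\<beta> * exp (- C * (lam + 1) powr (1 / real d)) * card X
       \<le> card {y \<in> X. (\<Sum>v\<in>W. f l x v * f l y v) \<ge> lam \<and> (\<forall>j\<in>{1..r} - {l}. (\<Sum>v\<in>W. f j x v * f j y v) \<ge> -1)}"
      (is "_ \<le> real (card ?X')")
    by (rule geom_property_uniform[OF geom X W, where f = f]) blast
  have bound: "(q i + a * \<alpha> i) * n i \<le> card (N i y \<inter> A i x)"
    if "i \<in> {1..r}" "y \<in> X" "a \<le> (\<Sum>v\<in>W. f i x v * f i y v)" for i y a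
  proof -
    have "0 < \<alpha> i * n i" using n \<alpha> that by simp
    with that(3) have "a * (\<alpha> i * n i) \<le> card (A i x \<inter> A i y) - q i * n i"
      unfolding Z[OF that(1) x that(2)] by (simp add: pos_le_divide_eq)
    moreover have "finite (A i x)" using A(2)[OF that(1) x] n[OF that(1)] by (metis card_ge_0_finite)
    \<comment> \<open>Going back from the trimmed \<open>A i y\<close> to the full neighbourhood of
      \<open>y\<close> can only raise the count.\<close>
    then have "card (A i x \<inter> A i y) \<le> card (N i y \<inter> A i x)"
      using A(1)[OF that(1,2)] by (intro card_mono) auto
    ultimately show ?thesis by (simp add: algebra_simps)
  qed
  show ?thesis
  proof (rule that[OF x _ l card, of "\<lambda>i. A i x"])
    \<comment> \<open>For \<open>i = l\<close> the bound -1 follows from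
      \<open>lam \<ge> -1\<close>.\<close>
    fix i y assume i: "i \<in> {1..r}" and y: "y \<in> ?X'"
    then have "(\<Sum>v\<in>W. f i x v * f i y v) \<ge> -1" using l by (cases "i = l") auto
    from bound[OF i _ this] y
    show "(n i / card (Y i) - \<alpha> i) * n i \<le> card (N i y \<inter> A i x)" by (simp add: q_def)
  qed (use A x l bound in \<open>auto simp: q_def\<close>)
qed

section \<open>Elementary estimates and the cost of a boost\<close>

text \<open>By concavity the logarithm lies above its chord between 1 and 2, whose slope
  \<open>ln 2\<close> is at least 2/3.\<close>

lemma ln_one_plus_ge_two_thirds:
  fixes x :: real
  assumes "0 \<le> x" "x \<le> 1"
  shows "2 / 3 * x \<le> ln (1 + x)"
proof -
  have "2 / 3 * x \<le> x * ln 2" using mult_left_mono[OF ln2_ge_two_thirds, of x] assms by (simp add: mult.commute)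
  also have "\<dots> \<le> ln (1 + x)"
    using concave_onD[OF ln_concave, of x 1 2] assms by (simp add: algebra_simps)
  finally show ?thesis .
qed

lemma exp_two_le_eight: "exp 2 \<le> (8 :: real)"
proof -
  have "2 \<le> ln ((2 :: real) ^ 3)" using ln2_ge_two_thirds by (subst ln_realpow) auto
  then show ?thesis by (subst (asm) ln_ge_iff) auto
qed

text \<open>The exponent is at most 1/3 and 8 is the cube of 2. Crude bounds such as
  \<open>lam + 1 \<le> 8 * lam\<close> thus cost only a factor 2.\<close>

lemma powr_inverse_mult_8_le:
  assumes "d \<ge> 3" "0 \<le> (x::real)"
  shows "(8 * x) powr (1 / real d) \<le> 2 * x powr (1 / real d)"
proof -
  have "8 powr (1 / real d) \<le> (8::real) powr (1 / 3)"
    using assms by (intro powr_mono) (auto simp: field_simps)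
  also have "\<dots> = (2 powr 3) powr (1/3)" by simp
  also have "\<dots> = 2" by (subst powr_powr) simp
  finally show ?thesis using assms by (simp add: powr_mult mult_right_mono)
qed

text \<open>A boost is charged a multiple of \<open>(lam + 1) powr (1 / real d)\<close> in the
  exponent; in terms of \<open>ln (1 + lam / t)\<close> the charges of all boosts add up to a
  multiple of \<open>s\<close>. For \<open>lam \<le> t\<close> the logarithm is comparable to
  \<open>lam / t\<close>; otherwise it is at least \<open>ln 2\<close>, and \<open>upper\<close>
  with the lower bound on \<open>t\<close> controls the charge.\<close>

lemma boost_cost:
  fixes lam0 lam \<delta> t :: real
  assumes d: "d \<ge> 3" and lam0: "1 \<le> lam0" "lam0 \<le> lam"
    and \<delta>: "0 < \<delta>" "\<delta> \<le> 1" and t: "t \<ge> lam0 * \<delta> powr (- 1 / (real d - 1))"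
    and upper: "1 + lam / t \<le> 8 / \<delta>"
  shows "(lam + 1) powr (1 / real d) \<le> 3 * t / lam0 powr ((real d - 1) / real d) * ln (1 + lam / t)"
proof -
  let ?\<Lambda> = "lam0 powr ((real d - 1) / real d)"
  have \<Lambda>: "?\<Lambda> > 0" using lam0 by simp
  have "0 < lam0 * \<delta> powr (- 1 / (real d - 1))" using lam0 \<delta> by simp
  with t have t0: "t > 0" by linarith
  have split: "x powr (1 / real d) * x powr ((real d - 1) / real d) = x" if "0 < x" for x :: real
    using that d unfolding powr_add[symmetric] add_divide_distrib[symmetric] by simp
  show ?thesis
  proof (cases "lam \<le> t")
    case True
    have "(lam + 1) powr (1 / real d) \<le> (8 * lam) powr (1 / real d)"
      using lam0 by (intro powr_mono2) auto
    also have "\<dots> \<le> 2 * lam powr (1 / real d)" using d lam0 by (intro powr_inverse_mult_8_le) auto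
    also have "lam powr (1 / real d) = lam / lam powr ((real d - 1) / real d)"
      using lam0 by (subst nonzero_eq_divide_eq) (simp_all add: split)
    also have "\<dots> \<le> lam / ?\<Lambda>"
      using lam0 d by (intro divide_left_mono powr_mono2) auto
    also have "lam \<le> 3 / 2 * t * ln (1 + lam / t)"
      using ln_one_plus_ge_two_thirds[of "lam / t"] True lam0 t0 by (simp add: field_simps)
    finally show ?thesis using \<Lambda> by (simp add: field_simps)
  next
    case False
    have "1 \<le> \<delta> powr (- 1 / (real d - 1))"
      using d \<delta> powr_mono'[of "- 1 / (real d - 1)" 0 \<delta>] by simp
    with lam0 have "1 \<le> lam0 * \<delta> powr (- 1 / (real d - 1))"
      using mult_mono[of 1 lam0 1] by simp
    with t t0 have "lam + 1 \<le> t * (1 + lam / t)" by (simp add: field_simps)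
    also have "\<dots> \<le> 8 * (t / \<delta>)" using mult_left_mono[OF upper, of t] t0 by (simp add: mult.commute)
    finally have "(lam + 1) powr (1 / real d) \<le> (8 * (t / \<delta>)) powr (1 / real d)"
      using lam0 by (intro powr_mono2) auto
    also have "\<dots> \<le> 2 * (t / \<delta>) powr (1 / real d)"
      using d t0 \<delta> by (intro powr_inverse_mult_8_le) auto
    also have "(t / \<delta>) powr (1 / real d) \<le> t / ?\<Lambda>"
    proof -
      \<comment> \<open>Raising the lower bound on \<open>t\<close> to the power
        \<open>(d - 1) / d\<close> turns the exponent \<open>- 1 / (d - 1)\<close> of \<delta> into
        \<open>- 1 / d\<close>.\<close>
      have "?\<Lambda> * \<delta> powr (- 1 / real d) = (lam0 * \<delta> powr (- 1 / (real d - 1))) powr ((real d - 1) / real d)"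
        using lam0 \<delta> d by (simp add: powr_mult powr_powr)
      also have "\<dots> \<le> t powr ((real d - 1) / real d)"
        using t lam0 d by (intro powr_mono2) auto
      finally have "?\<Lambda> * \<delta> powr (- 1 / real d) * t powr (1 / real d) \<le> t powr ((real d - 1) / real d) * t powr (1 / real d)"
        by (rule mult_right_mono) simp
      also have "\<dots> = t" using split[OF t0] by (simp add: mult.commute)
      also have "?\<Lambda> * \<delta> powr (- 1 / real d) * t powr (1 / real d) = ?\<Lambda> * (t / \<delta>) powr (1 / real d)"
        using t0 \<delta> by (simp add: powr_divide powr_minus field_simps)
      finally show ?thesis using \<Lambda> by (simp add: field_simps)
    qed
    also have "2 * (t / ?\<Lambda>) \<le> 2 * (t / ?\<Lambda>) * (3 / 2 * ln (1 + lam / t))"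
    proof -
      have "ln 2 \<le> ln (1 + lam / t)" using False t0 by (intro ln_mono) (auto simp: field_simps)
      then have "1 \<le> 3 / 2 * ln (1 + lam / t)" using ln2_ge_two_thirds by simp
      then show ?thesis using t0 \<Lambda> by (simp add: field_simps)
    qed
    finally show ?thesis by simp
  qed
qed

lemma sum_fun_upd:
  fixes g :: "'i \<Rightarrow> 'a \<Rightarrow> 'b :: ab_group_add"
  assumes "finite I" "j \<in> I"
  shows "(\<Sum>i\<in>I. g i ((f(j := v)) i)) = (\<Sum>i\<in>I. g i (f i)) + g j v - g j (f j)"
proof -
  have "(\<Sum>i\<in>I - {j}. g i ((f(j := v)) i)) = (\<Sum>i\<in>I - {j}. g i (f i))"
    by (rule sum.cong) auto
  then show ?thesis using assms by (simp add: sum.remove[of I j])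
qed

text \<open>Pigeonhole over the colours of the edges from \<open>x\<close> to \<open>X\<close>. The
  \<open>- 1\<close> discounts \<open>x\<close>, which may lie in \<open>X\<close> but in none of
  its own neighbourhoods.\<close>

lemma ex_popular_colour:
  assumes G: "edge_coloured_complete_graph V r c" and r: "r > 0" and x: "x \<in> V" and X: "X \<subseteq> V"
  shows "\<exists>j\<in>{1..r}. (real (card X) - 1) / r \<le> card (colour_nbhd V c j x \<inter> X)"
proof (rule ccontr)
  assume "\<not> ?thesis"
  then have "real (card (colour_nbhd V c j x \<inter> X)) < (real (card X) - 1) / r" if "j \<in> {1..r}" for j
    using that by (meson not_le)
  then have "(\<Sum>j\<in>{1..r}. real (card (colour_nbhd V c j x \<inter> X))) < (\<Sum>j\<in>{1..r}. (real (card X) - 1) / r)"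
    using r by (intro sum_strict_mono) auto
  also have "\<dots> = real (card X) - 1" using r by simp
  finally have less: "(\<Sum>j\<in>{1..r}. real (card (colour_nbhd V c j x \<inter> X))) < real (card X) - 1" .
  have fin: "finite X" using G X by (auto simp: edge_coloured_complete_graph_def intro: finite_subset)
  have "X - {x} \<subseteq> (\<Union>j\<in>{1..r}. colour_nbhd V c j x \<inter> X)"
    using G x X by (fastforce simp: edge_coloured_complete_graph_def colour_nbhd_def)
  then have "card (X - {x}) \<le> card (\<Union>j\<in>{1..r}. colour_nbhd V c j x \<inter> X)"
    using fin by (intro card_mono) auto
  also have "\<dots> \<le> (\<Sum>j\<in>{1..r}. card (colour_nbhd V c j x \<inter> X))"
    by (rule card_UN_le) simp
  finally have "real (card (X - {x})) \<le> (\<Sum>j\<in>{1..r}. real (card (colour_nbhd V c j x \<inter> X)))"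
    by (simp flip: of_nat_sum)
  moreover have "card X \<le> card (X - {x}) + 1"
    using fin by (cases "x \<in> X") (auto simp: card_Diff_singleton card_gt_0_iff)
  ultimately show False using less by linarith
qed

text \<open>The factor \<open>1 - 1 / t\<close> is the loss of excess density in a colour step; in
  this form \<open>t\<close> such steps visibly lose at most a factor \<open>exp 2\<close>.\<close>

lemma exp_minus_two_div_le:
  fixes t :: real
  assumes "t \<ge> 2"
  shows "exp (- (2 / t)) \<le> 1 - 1 / t"
proof -
  have "- (1 / t) - 2 * (1 / t)\<^sup>2 \<le> ln (1 - 1 / t)"
    using assms by (intro ln_one_minus_pos_lower_bound) auto
  moreover have "2 * (1 / t)\<^sup>2 \<le> 1 / t" using assms by (simp add: power2_eq_square field_simps)
  ultimately have "- (2 / t) \<le> ln (1 - 1 / t)" by simp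
  then show ?thesis using assms by (subst (asm) ln_ge_iff) auto
qed

section \<open>The state of the algorithm and its invariant\<close>

locale book_algorithm =
  fixes r d t :: nat and \<beta> C p \<delta> lam0 :: real
    and V X0 :: "'v set" and Y0 :: "nat \<Rightarrow> 'v set" and c :: "'v set \<Rightarrow> nat"
    and L \<rho> s0 K A D :: real
  defines "L \<equiv> ln (1 / \<delta>)" and "\<rho> \<equiv> ln (real r / \<beta>)"
    and "s0 \<equiv> 2 * lam0 / (3 * real t)" and "K \<equiv> ln (1 / (p - \<delta>))"
    and "A \<equiv> \<rho> + 2 * C * lam0 powr (1 / real d)"
    and "D \<equiv> \<rho> / s0 + 3 * C * t / lam0 powr ((real d - 1) / real d)"
  assumes r: "r \<ge> 2" and d: "d \<ge> 3" and \<beta>: "0 < \<beta>" "\<beta> \<le> 1" and C: "C > 0"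
    and geom: "geom_property r d \<beta> C"
    and p: "p \<le> 1" and \<delta>: "0 < \<delta>" "\<delta> < p" "\<delta> \<le> 1 / 4"
    and lam0: "lam0 \<ge> 2" and t: "t \<ge> lam0 * \<delta> powr (- 1 / (real d - 1))"
    and graph: "edge_coloured_complete_graph V r c"
    and X0: "X0 \<subseteq> V" and Y0: "\<And>i. i \<in> {1..r} \<Longrightarrow> Y0 i \<subseteq> V \<and> Y0 i \<noteq> {}"
    and dens0: "\<And>x i. x \<in> X0 \<Longrightarrow> i \<in> {1..r} \<Longrightarrow> p * card (Y0 i) \<le> card (colour_nbhd V c i x \<inter> Y0 i)"
    and X0_large: "2 * real r * t * exp (r * (A * t + D * (5 / 2 * L))) \<le> card X0"
begin

text \<open>The density guaranteed after \<open>k\<close> colour steps and boosts worth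
  \<open>s\<close>. It starts at \<open>dens 0 0 = p\<close>, and \<open>exp (- (2 / t))\<close>
  stands in for the factor \<open>1 - 1 / t\<close>.\<close>

definition dens :: "nat \<Rightarrow> real \<Rightarrow> real" where
  "dens k s = p - \<delta> + \<delta> * exp (s - 2 * k / t)"

text \<open>The constants: a boost in a colour adds at least \<open>s0\<close> to its \<open>s\<close>; a step costs at most a
  factor \<open>exp (- K)\<close> in the size of the set \<open>Y i\<close> it shrinks; in the size of \<open>X\<close> a colour step costs
  \<open>exp (- A)\<close> and a boost \<open>exp (- D * ln (1 + lam / t))\<close>.  The number \<open>s\<close> stands for the sum of \<open>ln (1 + lam / t)\<close> over the density boosts made so
  far in colour \<open>i\<close>.\<close>

definition good :: "nat \<Rightarrow> 'v set \<Rightarrow> 'v set \<Rightarrow> 'v set \<Rightarrow> real \<Rightarrow> bool" where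
  "good i X Y T s \<longleftrightarrow> Y \<subseteq> Y0 i \<and> T \<subseteq> X0 \<and> card T \<le> t \<and> colour_clique V c i T \<and>
     (\<forall>u\<in>T. X \<union> Y \<subseteq> colour_nbhd V c i u) \<and> 0 \<le> s \<and>
     (\<forall>x\<in>X. dens (card T) s * card Y \<le> card (colour_nbhd V c i x \<inter> Y)) \<and>
     exp (- K * (card T + s / s0)) * card (Y0 i) \<le> card Y"

text \<open>In a colour step \<open>x\<close> itself drops out when the popular colour is chosen, an
  additive loss of at most \<open>1 / r\<close>. The subtracted term sums these losses over all
  clique vertices.\<close>

definition large :: "'v set \<Rightarrow> (nat \<Rightarrow> 'v set) \<Rightarrow> (nat \<Rightarrow> real) \<Rightarrow> bool" where
  "large X T S \<longleftrightarrow> exp (- (\<Sum>i\<in>{1..r}. A * card (T i) + D * S i)) * card X0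
      - (\<Sum>i\<in>{1..r}. real (card (T i))) / r \<le> card X"

definition inv :: "'v set \<Rightarrow> (nat \<Rightarrow> 'v set) \<Rightarrow> (nat \<Rightarrow> 'v set) \<Rightarrow> (nat \<Rightarrow> real) \<Rightarrow> bool" where
  "inv X Y T S \<longleftrightarrow> X \<noteq> {} \<and> X \<subseteq> X0 \<and> (\<forall>i\<in>{1..r}. good i X (Y i) (T i) (S i)) \<and> large X T S"

lemma finite_V: "finite V"
  using graph by (simp add: edge_coloured_complete_graph_def)

lemma finite_X0: "finite X0"
  using X0 finite_V by (rule finite_subset)

lemma finite_Y0: "i \<in> {1..r} \<Longrightarrow> finite (Y0 i)"
  using Y0 finite_V finite_subset by blast

lemma t_ge: "lam0 \<le> t" "real t \<ge> 2"
proof -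
  have "1 \<le> \<delta> powr (- 1 / (real d - 1))"
    using d \<delta> powr_mono'[of "- 1 / (real d - 1)" 0 \<delta>] by simp
  then have "lam0 * 1 \<le> lam0 * \<delta> powr (- 1 / (real d - 1))"
    using lam0 by (intro mult_left_mono) auto
  with t show "lam0 \<le> t" by linarith
  with lam0 show "real t \<ge> 2" by linarith
qed

text \<open>The value 4/3 is what makes \<open>L + 2 \<le> 5 / 2 * L\<close>.\<close>

lemma L_ge: "4 / 3 \<le> L"
proof -
  have "4 / 3 \<le> 2 * ln (2 :: real)" using ln2_ge_two_thirds by simp
  also have "\<dots> = ln (2 ^ 2)" by (subst ln_realpow) auto
  also have "\<dots> \<le> L" unfolding L_def using \<delta> by (intro ln_mono) (auto simp: field_simps)
  finally show ?thesis .
qed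

lemma constants_nonneg: "0 \<le> \<rho>" "0 < s0" "0 \<le> K" "0 \<le> A" "0 \<le> D"
proof -
  have "1 \<le> r / \<beta>" using r \<beta> by (simp add: field_simps)
  then show \<rho>: "0 \<le> \<rho>" by (simp add: \<rho>_def)
  show s0: "0 < s0" using lam0 t_ge by (simp add: s0_def)
  show "0 \<le> K" using p \<delta> by (simp add: K_def field_simps)
  show "0 \<le> A" using \<rho> C by (simp add: A_def)
  show "0 \<le> D" using \<rho> s0 C by (simp add: D_def)
qed

lemma dens_ge: "p - \<delta> < dens k s"
  using \<delta> by (simp add: dens_def)

lemma card_good_pos:
  assumes "good i X Y T s" "i \<in> {1..r}"
  shows "0 < card Y"
proof -
  have "0 < exp (- K * (card T + s / s0)) * card (Y0 i)"
    using Y0 finite_Y0 assms(2) by (simp add: card_gt_0_iff)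
  also have "\<dots> \<le> card Y" using assms by (simp add: good_def)
  finally show ?thesis by simp
qed

lemma finite_good:
  assumes "good i X Y T s" "i \<in> {1..r}"
  shows "finite Y" "finite T"
  using assms finite_X0 finite_Y0 finite_subset unfolding good_def by blast+

text \<open>A density is at most 1, hence so is the excess, and \<open>card T \<le> t\<close> gives
  \<open>s \<le> L + 2\<close>. Nonemptiness of \<open>X\<close> supplies a vertex at which the
  density is measured.\<close>

lemma good_le:
  assumes good: "good i X Y T s" and i: "i \<in> {1..r}" and "X \<noteq> {}"
  shows "s \<le> 5 / 2 * L"
proof -
  obtain x where x: "x \<in> X" using \<open>X \<noteq> {}\<close> by auto
  have "dens (card T) s * card Y \<le> card (colour_nbhd V c i x \<inter> Y)"
    using good x by (simp add: good_def)
  also have "\<dots> \<le> card Y" using finite_good[OF good i] by (simp add: card_mono)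
  finally have "dens (card T) s \<le> 1" using card_good_pos[OF good i] by simp
  then have "\<delta> * exp (s - 2 * card T / t) \<le> 1" using \<delta> by (simp add: dens_def)
  then have "exp (s - 2 * card T / t) \<le> 1 / \<delta>" using \<delta> by (simp add: field_simps)
  then have "s - 2 * card T / t \<le> L" using \<delta> by (simp add: L_def ln_ge_iff)
  moreover have "2 * card T / t \<le> 2" using good t_ge by (simp add: good_def field_simps)
  ultimately show ?thesis using L_ge by simp
qed

text \<open>Since \<open>lam0 \<le> t\<close>, the linear lower bound for the logarithm applies at
  \<open>lam0 / t\<close>. Consequently \<open>s / s0\<close> bounds the number of boosts in a
  colour.\<close>

lemma s0_le_ln:
  assumes "lam \<ge> lam0"
  shows "s0 \<le> ln (1 + lam / t)"
proof -
  have "s0 \<le> ln (1 + lam0 / t)"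
    using ln_one_plus_ge_two_thirds[of "lam0 / t"] lam0 t_ge by (simp add: s0_def)
  also have "\<dots> \<le> ln (1 + lam / t)"
    using assms lam0 t_ge by (intro ln_mono) (auto simp: divide_right_mono add_pos_nonneg)
  finally show ?thesis .
qed

lemma good_subset: "good i X Y T s \<Longrightarrow> X' \<subseteq> X \<Longrightarrow> good i X' Y T s"
  unfolding good_def by blast

section \<open>Effect of one step on a single colour\<close>

text \<open>The loss is the fraction \<open>1 / t\<close> of the true excess
  \<open>q - p + \<delta>\<close>, so the excess keeps a factor of at least
  \<open>exp (- (2 / t))\<close>. Passing to \<open>Y'\<close> keeps the fraction \<open>q\<close>
  of \<open>Y\<close>, which exceeds \<open>p - \<delta> = exp (- K)\<close>.\<close>

lemma good_colour_step:
  assumes good: "good i X Y T s" and i: "i \<in> {1..r}" and X: "X \<subseteq> X0" and T: "card T < t"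
    and x: "x \<in> X" and Y': "Y' \<subseteq> colour_nbhd V c i x \<inter> Y" "card Y' = n"
    and q: "q = n / card Y" "dens (card T) s \<le> q"
    and X': "X' \<subseteq> X" "X' \<subseteq> colour_nbhd V c i x"
    and dens: "\<And>y. y \<in> X' \<Longrightarrow> (q - (q - p + \<delta>) / t) * n \<le> card (colour_nbhd V c i y \<inter> Y')"
  shows "good i X' Y' (insert x T) s"
proof -
  have nb: "X \<union> Y \<subseteq> colour_nbhd V c i u" if "u \<in> T" for u using good that by (simp add: good_def)
  have "x \<notin> T" using nb x by (force simp: colour_nbhd_def)
  then have cT: "card (insert x T) = card T + 1" using finite_good[OF good i] by simp
  have "colour_clique V c i (insert x T)"
    using good x X X0 nb unfolding good_def colour_clique_def colour_nbhd_def
    by (auto simp: insert_commute)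
  moreover have u0: "0 \<le> q - p + \<delta>" using q(2) dens_ge[of "card T" s] by linarith
  have "dens (card T + 1) s * n \<le> card (colour_nbhd V c i y \<inter> Y')" if "y \<in> X'" for y
  proof -
    have "\<delta> * exp (s - 2 * (card T + 1) / t) = \<delta> * exp (s - 2 * card T / t) * exp (- (2 / t))"
      by (simp add: exp_add[symmetric] add_divide_distrib diff_divide_distrib)
    also have "\<dots> \<le> (q - p + \<delta>) * (1 - 1 / t)"
      using u0 q(2) t_ge by (intro mult_mono exp_minus_two_div_le) (auto simp: dens_def)
    finally have "dens (card T + 1) s \<le> q - (q - p + \<delta>) / t"
      by (simp add: dens_def right_diff_distrib)
    then have "dens (card T + 1) s * n \<le> (q - (q - p + \<delta>) / t) * n" by (rule mult_right_mono) simp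
    with dens[OF that] show ?thesis by simp
  qed
  moreover have "exp (- K * (card T + 1 + s / s0)) * card (Y0 i) \<le> n"
  proof -
    have "exp (- K * (card T + 1 + s / s0)) * card (Y0 i)
        = exp (- K) * (exp (- K * (card T + s / s0)) * card (Y0 i))"
      by (simp add: exp_add[symmetric] algebra_simps)
    also have "\<dots> \<le> q * card Y"
      using good \<delta> q(2) dens_ge[of "card T" s]
      by (intro mult_mono) (auto simp: good_def K_def exp_minus ln_div)
    also have "\<dots> = n" using card_good_pos[OF good i] by (simp add: q)
    finally show ?thesis .
  qed
  moreover have "\<forall>u\<in>insert x T. X' \<union> Y' \<subseteq> colour_nbhd V c i u" using nb X' Y'(1) by blast
  ultimately show ?thesis
    using good T X x Y' unfolding good_def cT by auto
qed

text \<open>The gain is \<open>lam / t\<close> times the excess. The clique stays as it is: the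
  chosen vertex only served to shrink \<open>Y\<close>.\<close>

lemma good_boost_step:
  assumes good: "good i X Y T s" and i: "i \<in> {1..r}"
    and Y': "Y' \<subseteq> Y" "card Y' = n" and q: "q = n / card Y" "dens (card T) s \<le> q"
    and X': "X' \<subseteq> X" and lam: "lam \<ge> lam0"
    and dens: "\<And>y. y \<in> X' \<Longrightarrow> (q + lam * ((q - p + \<delta>) / t)) * n \<le> card (colour_nbhd V c i y \<inter> Y')"
  shows "good i X' Y' T (s + ln (1 + lam / t))"
proof -
  have pos: "1 + lam / t > 0" using lam lam0 t_ge by (simp add: add_pos_nonneg)
  have "dens (card T) (s + ln (1 + lam / t)) * n \<le> card (colour_nbhd V c i y \<inter> Y')" if "y \<in> X'" for y
  proof -
    have "\<delta> * exp (s + ln (1 + lam / t) - 2 * card T / t) = \<delta> * exp (s - 2 * card T / t) * (1 + lam / t)"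
      using pos by (simp add: exp_add exp_diff)
    also have "\<dots> \<le> (q - p + \<delta>) * (1 + lam / t)"
      using pos q(2) by (intro mult_right_mono) (auto simp: dens_def)
    also have "\<dots> = q - p + \<delta> + lam * ((q - p + \<delta>) / t)"
      by (simp add: algebra_simps add_divide_distrib diff_divide_distrib)
    finally have "dens (card T) (s + ln (1 + lam / t)) \<le> q + lam * ((q - p + \<delta>) / t)"
      by (simp add: dens_def)
    then have "dens (card T) (s + ln (1 + lam / t)) * n \<le> (q + lam * ((q - p + \<delta>) / t)) * n"
      by (rule mult_right_mono) simp
    with dens[OF that] show ?thesis by simp
  qed
  moreover have "exp (- K * (card T + (s + ln (1 + lam / t)) / s0)) * card (Y0 i) \<le> n"
  proof -
    \<comment> \<open>As \<open>card T\<close> does not grow, the factor \<open>exp (- K)\<close>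
      lost by \<open>Y\<close> is paid by \<open>s / s0\<close>, which grows by at least 1.\<close>
    have "K * 1 \<le> K * (ln (1 + lam / t) / s0)"
      using s0_le_ln[OF lam] constants_nonneg by (intro mult_left_mono) auto
    then have "exp (- K * (card T + (s + ln (1 + lam / t)) / s0)) * card (Y0 i)
        \<le> exp (- K - K * (card T + s / s0)) * card (Y0 i)"
      by (intro mult_right_mono) (simp_all add: algebra_simps add_divide_distrib)
    also have "\<dots> = exp (- K) * (exp (- K * (card T + s / s0)) * card (Y0 i))"
      by (simp add: exp_add[symmetric] algebra_simps)
    also have "\<dots> \<le> q * card Y"
      using good \<delta> q(2) dens_ge[of "card T" s]
      by (intro mult_mono) (auto simp: good_def K_def exp_minus ln_div)
    also have "\<dots> = n" using card_good_pos[OF good i] by (simp add: q)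
    finally show ?thesis .
  qed
  moreover have "0 \<le> ln (1 + lam / t)" using lam lam0 by simp
  moreover have "\<forall>u\<in>T. X' \<union> Y' \<subseteq> colour_nbhd V c i u" using good X' Y'(1) unfolding good_def by blast
  ultimately show ?thesis
    using good Y' unfolding good_def by auto
qed

section \<open>Preservation of the invariant\<close>

text \<open>The exponent in \<open>X0_large\<close> covers the largest possible cost,
  \<open>t\<close> colour steps and boosts worth \<open>5 / 2 * L\<close> in each of
  \<open>r\<close> colours. At least \<open>2 * r * t\<close> remains, while the subtracted term in
  \<open>large\<close> is at most \<open>t\<close>.\<close>

lemma large_imp_nonempty:
  assumes "large X T S" and bounds: "\<And>i. i \<in> {1..r} \<Longrightarrow> card (T i) \<le> t \<and> S i \<le> 5 / 2 * L"
  shows "X \<noteq> {}"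
proof -
  have "(\<Sum>i\<in>{1..r}. A * card (T i) + D * S i) \<le> (\<Sum>i\<in>{1..r}. A * t + D * (5 / 2 * L))"
    using bounds constants_nonneg by (intro sum_mono add_mono mult_left_mono) auto
  then have "exp (- (r * (A * t + D * (5 / 2 * L)))) * card X0
      \<le> exp (- (\<Sum>i\<in>{1..r}. A * card (T i) + D * S i)) * card X0"
    by (intro mult_right_mono) auto
  moreover have "exp (- (r * (A * t + D * (5 / 2 * L)))) * (2 * real r * t * exp (r * (A * t + D * (5 / 2 * L))))
      \<le> exp (- (r * (A * t + D * (5 / 2 * L)))) * card X0"
    by (rule mult_left_mono[OF X0_large]) simp
  then have "2 * real r * t \<le> exp (- (r * (A * t + D * (5 / 2 * L)))) * card X0"
    by (simp add: exp_minus field_simps)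
  moreover have "(\<Sum>i\<in>{1..r}. real (card (T i))) / r \<le> t"
    using sum_bounded_above[of "{1..r}" "\<lambda>i. real (card (T i))" t] bounds r by (simp add: field_simps)
  moreover have "real t < 2 * real r * t" using r t_ge by simp
  ultimately have "0 < real (card X)" using \<open>large X T S\<close> unfolding large_def by linarith
  then show ?thesis by auto
qed

text \<open>The sum of sizes is the termination measure: a colour step removes \<open>x\<close> from
  \<open>X\<close>, and a boost makes \<open>Y l\<close> strictly smaller.\<close>

lemma inv_step:
  assumes inv: "inv X Y T S" and small: "\<And>i. i \<in> {1..r} \<Longrightarrow> card (T i) < t"
  obtains X' Y' T' S' where "inv X' Y' T' S'"
    "card X' + (\<Sum>i\<in>{1..r}. card (Y' i)) < card X + (\<Sum>i\<in>{1..r}. card (Y i))"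
proof -
  let ?nb = "colour_nbhd V c"
  have X: "X \<noteq> {}" "X \<subseteq> X0" and good: "\<And>i. i \<in> {1..r} \<Longrightarrow> good i X (Y i) (T i) (S i)"
    and large: "large X T S"
    using inv by (auto simp: inv_def)
  have finX: "finite X" using X(2) finite_X0 by (rule finite_subset)
  \<comment> \<open>The guaranteed neighbourhood size, rounded up: every neighbourhood, having
    integer size, still reaches it, and its density \<open>q i\<close> is no smaller than
    \<open>dens\<close>.\<close>
  define n where "n i = nat \<lceil>dens (card (T i)) (S i) * card (Y i)\<rceil>" for i
  define q where "q i = real (n i) / card (Y i)" for i
  \<comment> \<open>With this unit a loss of \<alpha> multiplies the excess by
    \<open>1 - 1 / t\<close>, and a gain of \<open>lam\<close> units by
    \<open>1 + lam / t\<close>.\<close>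
  define \<alpha> where "\<alpha> i = (q i - p + \<delta>) / t" for i
  have dens_pos: "0 < dens k s" for k s using dens_ge[of k s] \<delta> by linarith
  have n_pos: "0 < n i" if "i \<in> {1..r}" for i
    using card_good_pos[OF good that] that dens_pos by (simp add: n_def)
  have q_ge: "dens (card (T i)) (S i) \<le> q i" if "i \<in> {1..r}" for i
    unfolding q_def n_def
    using card_good_pos[OF good that] that real_nat_ceiling_ge by (simp add: pos_le_divide_eq)
  have u_pos: "0 < q i - p + \<delta>" if "i \<in> {1..r}" for i
    using q_ge[OF that] dens_ge[of "card (T i)" "S i"] by linarith
  have \<alpha>_pos: "0 < \<alpha> i" if "i \<in> {1..r}" for i
    using u_pos[OF that] t_ge by (simp add: \<alpha>_def)
  have n_le: "n i \<le> card (?nb i x \<inter> Y i)" if "i \<in> {1..r}" "x \<in> X" for i x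
  proof -
    have "dens (card (T i)) (S i) * card (Y i) \<le> card (?nb i x \<inter> Y i)"
      using good[OF that(1)] that(2) by (simp add: good_def)
    then show ?thesis unfolding n_def by linarith
  qed
  obtain x X' Y' l lam where x: "x \<in> X" and X': "X' \<subseteq> X" and l: "l \<in> {1..r}" "lam \<ge> -1"
    and cX': "card X' \<ge> \<beta> * exp (- C * (lam + 1) powr (1 / real d)) * card X"
    and Y': "\<And>i. i \<in> {1..r} \<Longrightarrow> Y' i \<subseteq> ?nb i x \<inter> Y i" "\<And>i. i \<in> {1..r} \<Longrightarrow> card (Y' i) = n i"
    and up: "\<And>y. y \<in> X' \<Longrightarrow> (n l / card (Y l) + lam * \<alpha> l) * n l \<le> card (?nb l y \<inter> Y' l)"
    and down: "\<And>i y. i \<in> {1..r} \<Longrightarrow> y \<in> X' \<Longrightarrow> (n i / card (Y i) - \<alpha> i) * n i \<le> card (?nb i y \<inter> Y' i)"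
  proof (rule book_step[OF geom finX X(1), where Y = Y and n = n and N = ?nb and \<alpha> = \<alpha>])
    show "finite (Y i)" if "i \<in> {1..r}" for i using finite_good(1)[OF good] that by blast
    show "0 < n i" if "i \<in> {1..r}" for i using n_pos that .
    show "n i \<le> card (?nb i x \<inter> Y i)" if "i \<in> {1..r}" "x \<in> X" for i x using n_le that .
    show "0 < \<alpha> i" if "i \<in> {1..r}" for i using \<alpha>_pos that .
  qed (rule that)
  note up = up[folded q_def] and down = down[folded q_def]
  define b where "b = \<beta> * exp (- C * (lam + 1) powr (1 / real d))"
  have b: "0 < b" "b \<le> 1" "b * card X \<le> card X'"
  proof -
    have "exp (- C * (lam + 1) powr (1 / real d)) \<le> 1" using C by simp
    then show "b \<le> 1" using \<beta> mult_mono[of \<beta> 1 _ 1] by (simp add: b_def)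
  qed (use \<beta> cX' in \<open>simp_all add: b_def\<close>)
  define E where "E = (\<Sum>i\<in>{1..r}. A * card (T i) + D * S i)"
  define \<tau> where "\<tau> = (\<Sum>i\<in>{1..r}. real (card (T i)))"
  have \<tau>: "0 \<le> \<tau>" by (simp add: \<tau>_def sum_nonneg)
  have cX: "exp (- E) * card X0 - \<tau> / r \<le> card X"
    using large by (simp add: large_def E_def \<tau>_def)
  have finX': "finite X'" using X' finX by (rule finite_subset)
  have "0 < b * card X" using b X(1) finX by (simp add: card_gt_0_iff)
  with b have X'_ne: "X' \<noteq> {}" by auto
  show ?thesis
  proof (cases "lam \<le> lam0")
    case True
    have "x \<in> V" "X' \<subseteq> V" "0 < r" using x X(2) X' X0 r by auto
    \<comment> \<open>The colour \<open>j\<close> need not be the colour \<open>l\<close> of the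
      geometric step; only the lower bound common to all colours is used for it.\<close>
    then obtain j where j: "j \<in> {1..r}" and cj: "(real (card X') - 1) / r \<le> card (?nb j x \<inter> X')"
      using ex_popular_colour[OF graph] by blast
    let ?X = "?nb j x \<inter> X'" and ?Y = "Y(j := Y' j)" and ?T = "T(j := insert x (T j))"
    have gj: "good j ?X (Y' j) (insert x (T j)) (S j)"
    proof (rule good_colour_step[OF good[OF j] j X(2) small[OF j] x Y'(1)[OF j] Y'(2)[OF j] q_def q_ge[OF j]])
      fix y assume "y \<in> ?X"
      then show "(q j - (q j - p + \<delta>) / t) * n j \<le> card (?nb j y \<inter> Y' j)"
        using down[OF j] by (simp add: \<alpha>_def)
    qed (use X' in auto)
    have g: "good i ?X (?Y i) (?T i) (S i)" if "i \<in> {1..r}" for i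
    proof -
      have "?X \<subseteq> X" using X' by auto
      from good_subset[OF good[OF that] this] gj show ?thesis by auto
    qed
    have xT: "card (insert x (T j)) = card (T j) + 1"
    proof -
      have "x \<notin> T j" using good[OF j] x by (force simp: good_def colour_nbhd_def)
      then show ?thesis using finite_good(2)[OF good[OF j] j] by simp
    qed
    have "large ?X ?T S"
    proof -
      have "(\<Sum>i\<in>{1..r}. A * card (?T i) + D * S i) = E + A"
        using sum_fun_upd[OF _ j, where g = "\<lambda>i T. A * card T + D * S i" and f = T and v = "insert x (T j)"] xT
        by (simp add: E_def algebra_simps)
      moreover have "(\<Sum>i\<in>{1..r}. real (card (?T i))) = \<tau> + 1"
        using sum_fun_upd[OF _ j, where g = "\<lambda>i T. real (card T)" and f = T and v = "insert x (T j)"] xT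
        by (simp add: \<tau>_def)
      moreover have "exp (- (E + A)) * card X0 - (\<tau> + 1) / r \<le> card ?X"
      proof -
        \<comment> \<open>The constant \<open>A\<close> pays for the factor
          \<open>\<beta> / r\<close> through \<rho> and for the exponential through
          \<open>lam + 1 \<le> 8 * lam0\<close>.\<close>
        have "(lam + 1) powr (1 / real d) \<le> (8 * lam0) powr (1 / real d)"
          using True l lam0 by (intro powr_mono2) auto
        also have "\<dots> \<le> 2 * lam0 powr (1 / real d)"
          using d lam0 by (intro powr_inverse_mult_8_le) auto
        finally have "exp (- A) \<le> exp (- \<rho> - C * (lam + 1) powr (1 / real d))"
          using C by (simp add: A_def)
        also have "\<dots> = b / r"
          using r \<beta> by (simp add: \<rho>_def b_def exp_diff exp_add exp_minus ln_div field_simps)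
        finally have "exp (- A) * (exp (- E) * card X0) \<le> b / r * (exp (- E) * card X0)"
          by (rule mult_right_mono) simp
        also have "\<dots> \<le> b / r * (card X + \<tau> / r)"
          using b cX by (intro mult_left_mono) auto
        also have "\<dots> \<le> card X' / r + \<tau> / r"
        proof -
          have "\<tau> / r \<le> \<tau>" using \<tau> r mult_left_mono[of 1 "real r" \<tau>] by (simp add: field_simps)
          then have "b * (\<tau> / r) \<le> 1 * \<tau>" using b \<tau> by (intro mult_mono) auto
          with b(3) have "b * (card X + \<tau> / r) \<le> card X' + \<tau>" by (simp add: algebra_simps)
          from divide_right_mono[OF this, of r] show ?thesis by (simp add: add_divide_distrib)
        qed
        also have "\<dots> \<le> card ?X + 1 / r + \<tau> / r" using cj by (simp add: diff_divide_distrib)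
        finally have "exp (- A) * (exp (- E) * card X0) \<le> card ?X + 1 / r + \<tau> / r" .
        moreover have "exp (- (E + A)) = exp (- A) * exp (- E)"
          by (simp add: exp_add[symmetric] algebra_simps)
        ultimately show ?thesis by (simp only: mult.assoc add_divide_distrib)
      qed
      ultimately show ?thesis unfolding large_def by simp
    qed
    \<comment> \<open>The popular neighbourhood might be empty by its local bound alone, so the
      global size is used. \<open>S\<close> is unchanged, hence bounded through the old, nonempty
      reservoir.\<close>
    moreover have "?X \<noteq> {}"
    proof (rule large_imp_nonempty[OF \<open>large ?X ?T S\<close>])
      fix i assume i: "i \<in> {1..r}"
      show "card (?T i) \<le> t \<and> S i \<le> 5 / 2 * L"
        using g[OF i] good_le[OF good[OF i] i X(1)] by (simp add: good_def)
    qed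
    moreover have "?X \<subseteq> X0" using X X' by auto
    ultimately have "inv ?X ?Y ?T S" using g by (simp add: inv_def)
    moreover have "card ?X < card X"
      using x X' finX by (intro psubset_card_mono) (auto simp: colour_nbhd_def)
    moreover have "(\<Sum>i\<in>{1..r}. card (?Y i)) \<le> (\<Sum>i\<in>{1..r}. card (Y i))"
      using Y'(1)[OF j] finite_good(1)[OF good[OF j] j] by (intro sum_mono) (auto intro: card_mono)
    ultimately show ?thesis by (intro that) auto
  next
    case False
    let ?Y = "Y(l := Y' l)" and ?S = "S(l := S l + ln (1 + lam / t))"
    have gl: "good l X' (Y' l) (T l) (S l + ln (1 + lam / t))"
      using Y'(1)[OF l(1)] Y'(2)[OF l(1)] X' False up l
      by (intro good_boost_step[OF good[OF l(1)] l(1) _ _ q_def q_ge]) (auto simp: \<alpha>_def)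
    have g: "good i X' (?Y i) (T i) (?S i)" if "i \<in> {1..r}" for i
      using gl good_subset[OF good[OF that] X'] that by auto
    \<comment> \<open>The new density at \<open>y\<close> cannot exceed 1. This limits
      \<open>lam\<close> and also forces \<open>q l < 1\<close>.\<close>
    obtain y where y: "y \<in> X'" using X'_ne by auto
    have "(q l + lam * \<alpha> l) * n l \<le> card (?nb l y \<inter> Y' l)" by (rule up[OF y])
    also have "\<dots> \<le> n l"
      using Y'(2)[OF l(1)] n_pos[OF l(1)] by (metis card_ge_0_finite card_mono inf_le2 of_nat_le_iff)
    finally have q1: "q l + lam * \<alpha> l \<le> 1" using n_pos[OF l(1)] by simp
    have "large X' T ?S"
    proof -
      have "(\<Sum>i\<in>{1..r}. A * card (T i) + D * ?S i) = E + D * ln (1 + lam / t)"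
        using sum_fun_upd[OF _ l(1), where g = "\<lambda>i s. A * card (T i) + D * s" and f = S
            and v = "S l + ln (1 + lam / t)"]
        by (simp add: E_def algebra_simps)
      moreover have "exp (- (E + D * ln (1 + lam / t))) * card X0 - \<tau> / r \<le> card X'"
      proof -
        \<comment> \<open>Before the boost the excess is at least
          \<open>\<delta> * exp (- 2)\<close>, after it at most 1.\<close>
        have upper: "1 + lam / t \<le> 8 / \<delta>"
        proof -
          have "2 * card (T l) / t \<le> 2" "0 \<le> S l"
            using good[OF l(1)] t_ge by (simp_all add: good_def pos_divide_le_eq)
          then have "\<delta> * exp (- 2) \<le> \<delta> * exp (S l - 2 * card (T l) / t)"
            using \<delta> by (intro mult_left_mono) auto
          also have "\<dots> \<le> q l - p + \<delta>" using q_ge[OF l(1)] by (simp add: dens_def)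
          finally have "\<delta> * exp (- 2) * (1 + lam / t) \<le> (q l - p + \<delta>) * (1 + lam / t)"
            using False lam0 t_ge by (intro mult_right_mono) auto
          also have "\<dots> = q l + lam * \<alpha> l - p + \<delta>" by (simp add: \<alpha>_def algebra_simps add_divide_distrib diff_divide_distrib)
          also have "\<dots> \<le> 1" using q1 \<delta> by simp
          finally have "1 + lam / t \<le> exp 2 / \<delta>" using \<delta> by (simp add: exp_minus field_simps)
          also have "\<dots> \<le> 8 / \<delta>" using exp_two_le_eight \<delta> by (simp add: divide_right_mono)
          finally show ?thesis .
        qed
        \<comment> \<open>The two summands of \<open>D\<close> pay separately: the second for the
          exponential, by \<open>boost_cost\<close>, and \<open>\<rho> / s0\<close> for the factor
          \<beta>, because the logarithm is at least \<open>s0\<close>.\<close>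
        have "(lam + 1) powr (1 / real d) \<le> 3 * real t / lam0 powr ((real d - 1) / real d) * ln (1 + lam / t)"
          using False lam0 \<delta> t upper d by (intro boost_cost[where \<delta> = \<delta>]) auto
        then have "C * (lam + 1) powr (1 / real d)
            \<le> C * (3 * real t / lam0 powr ((real d - 1) / real d) * ln (1 + lam / t))"
          using C by (intro mult_left_mono) auto
        moreover have "ln (1 / \<beta>) \<le> \<rho> / s0 * ln (1 + lam / t)"
        proof -
          have "ln (1 / \<beta>) \<le> \<rho>" unfolding \<rho>_def using r \<beta> by (intro ln_mono) (auto simp: divide_right_mono)
          also have "\<rho> * 1 \<le> \<rho> * (ln (1 + lam / t) / s0)"
            using s0_le_ln[of lam] False constants_nonneg by (intro mult_left_mono) auto
          finally show ?thesis by simp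
        qed
        ultimately have "- D * ln (1 + lam / t) \<le> ln \<beta> - C * (lam + 1) powr (1 / real d)"
          using \<beta> by (simp add: D_def ln_div algebra_simps)
        then have "exp (- D * ln (1 + lam / t)) \<le> exp (ln \<beta> - C * (lam + 1) powr (1 / real d))"
          by simp
        also have "\<dots> = b" using \<beta> by (simp add: b_def exp_diff exp_minus field_simps)
        finally have "exp (- D * ln (1 + lam / t)) * (exp (- E) * card X0) \<le> b * (exp (- E) * card X0)"
          by (rule mult_right_mono) simp
        also have "\<dots> \<le> b * (card X + \<tau> / r)" using b cX by (intro mult_left_mono) auto
        also have "\<dots> \<le> card X' + \<tau> / r"
        proof -
          have "b * (\<tau> / r) \<le> 1 * (\<tau> / r)" using b \<tau> r by (intro mult_right_mono) auto
          with b(3) show ?thesis by (simp add: algebra_simps)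
        qed
        finally have "exp (- D * ln (1 + lam / t)) * (exp (- E) * card X0) \<le> card X' + \<tau> / r" .
        moreover have "exp (- (E + D * ln (1 + lam / t))) = exp (- D * ln (1 + lam / t)) * exp (- E)"
          by (simp add: exp_add[symmetric] algebra_simps)
        ultimately show ?thesis by (simp only: mult.assoc)
      qed
      ultimately show ?thesis unfolding large_def \<tau>_def by simp
    qed
    moreover have "X' \<subseteq> X0" using X X' by auto
    ultimately have "inv X' ?Y T ?S" using g X'_ne by (simp add: inv_def)
    moreover have "card X' \<le> card X" using X' finX by (simp add: card_mono)
    moreover have "(\<Sum>i\<in>{1..r}. card (?Y i)) < (\<Sum>i\<in>{1..r}. card (Y i))"
    proof -
      have "0 < lam * \<alpha> l" using False lam0 \<alpha>_pos[OF l(1)] by simp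
      with q1 have "q l < 1" by simp
      then have "card (Y' l) < card (Y l)"
        using card_good_pos[OF good[OF l(1)] l(1)] Y'(2)[OF l(1)] by (simp add: q_def)
      then show ?thesis using l(1)
        by (intro sum_strict_mono_ex1) auto
    qed
    ultimately show ?thesis by (intro that) auto
  qed
qed

section \<open>Running the algorithm\<close>

lemma inv_init: "inv X0 Y0 (\<lambda>_. {}) (\<lambda>_. 0)"
proof -
  have "0 < 2 * real r * t * exp (r * (A * t + D * (5 / 2 * L)))" using r t_ge by simp
  with X0_large have "X0 \<noteq> {}" by auto
  moreover have "good i X0 (Y0 i) {} 0" if "i \<in> {1..r}" for i
    using dens0 that by (auto simp: good_def dens_def colour_clique_def)
  moreover have "large X0 (\<lambda>_. {}) (\<lambda>_. 0)" by (simp add: large_def)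
  ultimately show ?thesis by (simp add: inv_def)
qed

text \<open>\<open>inv_step\<close> applies until some clique has size \<open>t\<close>, which the
  decreasing measure enforces. The exponent counts \<open>t\<close> colour steps and at most
  \<open>5 / 2 * L / s0\<close> boosts, each costing at most a factor
  \<open>exp (- K)\<close>.\<close>

theorem ex_book:
  obtains i T P where "i \<in> {1..r}" "T \<subseteq> X0" "colour_clique V c i T" "card T = t"
    "P \<subseteq> Y0 i" "\<And>u. u \<in> T \<Longrightarrow> P \<subseteq> colour_nbhd V c i u"
    "exp (- K * (t + 5 / 2 * L / s0)) * card (Y0 i) \<le> card P"
proof -
  have "\<exists>X Y T S. inv X Y T S \<and> (\<exists>i\<in>{1..r}. card (T i) = t)"
    if "inv X Y T S" for X Y T S
    using that
  proof (induction "card X + (\<Sum>i\<in>{1..r}. card (Y i))" arbitrary: X Y T S rule: less_induct)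
    case less
    show ?case
    proof (cases "\<exists>i\<in>{1..r}. card (T i) = t")
      case False
      then have "card (T i) < t" if "i \<in> {1..r}" for i
        using less.prems that by (auto simp: inv_def good_def order.order_iff_strict)
      then obtain X' Y' T' S' where "inv X' Y' T' S'"
        "card X' + (\<Sum>i\<in>{1..r}. card (Y' i)) < card X + (\<Sum>i\<in>{1..r}. card (Y i))"
        using inv_step[OF less.prems] by metis
      then show ?thesis using less.hyps by blast
    qed (use less.prems in blast)
  qed
  then obtain X Y T S i where inv: "inv X Y T S" and i: "i \<in> {1..r}" "card (T i) = t"
    using inv_init by blast
  have good: "good i X (Y i) (T i) (S i)" and X: "X \<noteq> {}" using inv i by (auto simp: inv_def)
  have "S i / s0 \<le> 5 / 2 * L / s0"
    using good_le[OF good i(1) X] constants_nonneg by (intro divide_right_mono) auto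
  then have "K * (t + S i / s0) \<le> K * (t + 5 / 2 * L / s0)"
    using constants_nonneg by (intro mult_left_mono) auto
  then have "exp (- K * (t + 5 / 2 * L / s0)) * card (Y0 i) \<le> exp (- K * (t + S i / s0)) * card (Y0 i)"
    by (intro mult_right_mono) auto
  also have "\<dots> \<le> card (Y i)" using good i by (simp add: good_def)
  finally have "exp (- K * (t + 5 / 2 * L / s0)) * card (Y0 i) \<le> card (Y i)" .
  then show ?thesis using good i by (intro that[of i "T i" "Y i"]) (auto simp: good_def)
qed

end

section \<open>Comparison with the constants of the theorem\<close>

theorem theorem4p2:
  fixes r d t m :: nat
    and \<beta> C p \<delta> lam0 L L\<^sub>p \<rho> BigPi BigXi :: real
    and V X :: "'v set"
    and Y :: "nat \<Rightarrow> 'v set"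
    and c :: "'v set \<Rightarrow> nat"
  assumes "r \<ge> 2" and "d \<ge> 3"
    and "0 < \<beta>" and "\<beta> \<le> 1" and "C > 0"
    and "geom_property r d \<beta> C"
    and "t > 0" and "m > 0"
    and "0 < p" and "p \<le> 1"
    and "\<delta> > 0" and "lam0 > 0"
    and "L = ln (1 / \<delta>)" and "L\<^sub>p = ln (1 / p)" and "\<rho> = ln (real r / \<beta>)"
    and "\<delta> \<le> min (p / 4) (1 / 4)"
    and "lam0 \<ge> max 2 (6 * L)"
    and "real t \<ge> lam0 * \<delta> powr (- 1 / (real d - 1))"
    and "BigPi = 3 * \<delta> / p + 6 * L * L\<^sub>p / lam0"
    and "BigXi = 2 * \<rho> + 4 * C * lam0 powr (1 / real d)
              + 12 * C * L / lam0 powr ((real d - 1) / real d)"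
    and "edge_coloured_complete_graph V r c"
    and "X \<subseteq> V" and "X \<noteq> {}"
    and "\<And>i. i \<in> {1..r} \<Longrightarrow> Y i \<subseteq> V \<and> Y i \<noteq> {}"
    and "\<And>x i. x \<in> X \<Longrightarrow> i \<in> {1..r} \<Longrightarrow>
           real (card (colour_nbhd V c i x \<inter> Y i)) \<ge> p * real (card (Y i))"
    and "\<And>i. i \<in> {1..r} \<Longrightarrow>
           real (card (Y i)) \<ge> p powr (- real t) * exp (BigPi * real t) * real m"
    and "real (card X) \<ge> 2 * real r * real t * exp (real r * real t * BigXi)"
  shows "\<exists>i\<in>{1..r}. \<exists>T P.
           T \<subseteq> X \<and> colour_clique V c i T \<and> card T = t \<and>
           P \<subseteq> Y i - T \<and> card P = m \<and>
           (\<forall>u\<in>T. \<forall>w\<in>P. c {u, w} = i) \<and>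
           colour_tm_book V c i t m T P"
proof -
  note L = assms(13) and Lp = assms(14) and \<rho> = assms(15)
  define A where "A = \<rho> + 2 * C * lam0 powr (1 / real d)"
  define s0 where "s0 = 2 * lam0 / (3 * real t)"
  define D where "D = \<rho> / s0 + 3 * C * t / lam0 powr ((real d - 1) / real d)"
  have lam0: "2 \<le> lam0" "6 * L \<le> lam0" and \<delta>: "\<delta> \<le> p / 4" "\<delta> \<le> 1 / 4" "\<delta> < p"
    using assms by auto
  have L0: "0 \<le> L" using \<delta> \<open>\<delta> > 0\<close> by (simp add: L)
  have Lp0: "0 \<le> L\<^sub>p" using \<open>0 < p\<close> \<open>p \<le> 1\<close> by (simp add: Lp)
  have \<rho>0: "0 \<le> \<rho>" using \<open>r \<ge> 2\<close> \<open>0 < \<beta>\<close> \<open>\<beta> \<le> 1\<close> by (simp add: \<rho> field_simps)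
  \<comment> \<open>This bounds the number of boosts in one colour; \<open>6 * L \<le> lam0\<close>
    makes it at most \<open>5 / 8 * t\<close>.\<close>
  let ?\<epsilon> = "5 / 2 * L / s0"
  have \<epsilon>: "?\<epsilon> = t * (15 / 4 * L / lam0)" using lam0 by (simp add: s0_def field_simps)
  have ratio: "15 / 4 * L / lam0 \<le> 5 / 8" using lam0 by (simp add: field_simps)
  \<comment> \<open>One \<rho> of \<open>BigXi\<close> comes from \<open>A\<close>, the other from
    the boosts. The remaining coefficients leave slack: 2 against 4 and 15/2 against 12.\<close>
  have "A * t + D * (5 / 2 * L) \<le> t * BigXi"
  proof -
    have "\<rho> / s0 * (5 / 2 * L) = \<rho> * ?\<epsilon>" by simp
    also have "\<dots> = t * (\<rho> * (15 / 4 * L / lam0))" unfolding \<epsilon> by (simp only: mult_ac)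
    also have "\<dots> \<le> t * (\<rho> * 1)" using ratio \<rho>0 by (intro mult_left_mono) auto
    finally have "\<rho> / s0 * (5 / 2 * L) \<le> t * \<rho>" by simp
    moreover define a where "a = t * (C * L / lam0 powr ((real d - 1) / real d))"
    moreover define b where "b = t * (C * lam0 powr (1 / real d))"
    moreover have "0 \<le> a" "0 \<le> b" using L0 \<open>C > 0\<close> by (simp_all add: a_def b_def)
    moreover have "A * t = t * \<rho> + 2 * b" by (simp add: A_def b_def algebra_simps)
    moreover have "D * (5 / 2 * L) = \<rho> / s0 * (5 / 2 * L) + 15 / 2 * a"
      unfolding D_def a_def distrib_right by (simp add: mult_ac)
    moreover have "t * BigXi = 2 * (t * \<rho>) + 4 * b + 12 * a"
      by (simp add: assms(20) a_def b_def distrib_left)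
    ultimately show ?thesis by linarith
  qed
  then have "r * (A * t + D * (5 / 2 * L)) \<le> real r * real t * BigXi"
    by (simp add: mult.assoc mult_left_mono)
  then have "2 * real r * t * exp (r * (A * t + D * (5 / 2 * L))) \<le> 2 * real r * real t * exp (real r * real t * BigXi)"
    by (intro mult_left_mono) auto
  with assms(27) have X_large: "2 * real r * t * exp (r * (A * t + D * (5 / 2 * L))) \<le> card X"
    by linarith
  interpret book_algorithm r d t \<beta> C p \<delta> lam0 V X Y c L \<rho> s0 "ln (1 / (p - \<delta>))" A D
    by unfold_locales (use assms \<delta> lam0 X_large in \<open>simp_all add: L \<rho> s0_def A_def D_def\<close>)
  obtain i T P where i: "i \<in> {1..r}" and T: "T \<subseteq> X" "colour_clique V c i T" "card T = t"
    and P: "P \<subseteq> Y i" "\<And>u. u \<in> T \<Longrightarrow> P \<subseteq> colour_nbhd V c i u"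
    and cP: "exp (- ln (1 / (p - \<delta>)) * (t + ?\<epsilon>)) * card (Y i) \<le> card P"
    by (rule ex_book) (rule that)
  \<comment> \<open>Split off \<open>ln (p / (p - \<delta>))\<close>;
    \<open>\<delta> \<le> p / 4\<close> bounds it by \<open>\<delta> / (3 / 4 * p)\<close>.\<close>
  have "ln (1 / (p - \<delta>)) \<le> L\<^sub>p + 4 / 3 * (\<delta> / p)"
  proof -
    have "ln (p / (p - \<delta>)) \<le> p / (p - \<delta>) - 1" using \<delta> \<open>0 < p\<close> by (intro ln_le_minus_one) auto
    also have "\<dots> = \<delta> / (p - \<delta>)" using \<delta> by (simp add: field_simps)
    also have "\<dots> \<le> \<delta> / (3 / 4 * p)"
    proof (rule divide_left_mono)
      show "3 / 4 * p \<le> p - \<delta>" using \<open>\<delta> \<le> p / 4\<close> by simp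
    qed (use \<delta> \<open>0 < p\<close> \<open>\<delta> > 0\<close> in auto)
    finally show ?thesis using \<delta> \<open>0 < p\<close> by (simp add: Lp ln_div)
  qed
  moreover have "0 \<le> ?\<epsilon>" using L0 lam0 unfolding \<epsilon> by simp
  ultimately have "ln (1 / (p - \<delta>)) * (t + ?\<epsilon>) \<le> (L\<^sub>p + 4 / 3 * (\<delta> / p)) * (t + ?\<epsilon>)"
    by (intro mult_right_mono add_nonneg_nonneg) simp_all
  also have "\<dots> = t * (L\<^sub>p + 15 / 4 * (L * L\<^sub>p / lam0) + 4 / 3 * (\<delta> / p) * (1 + 15 / 4 * L / lam0))"
    unfolding \<epsilon> by (simp add: algebra_simps add_divide_distrib)
  \<comment> \<open>The factor \<open>1 + 15 / 4 * L / lam0\<close> is at most 13/8, below the 9/4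
    that gives \<open>4 / 3 * (9 / 4) = 3\<close>.\<close>
  also have "\<dots> \<le> t * (L\<^sub>p + 6 * (L * L\<^sub>p / lam0) + 3 * (\<delta> / p))"
  proof -
    have "4 / 3 * (\<delta> / p) * (1 + 15 / 4 * L / lam0) \<le> 4 / 3 * (\<delta> / p) * (9 / 4)"
      using ratio \<open>\<delta> > 0\<close> \<open>0 < p\<close> by (intro mult_left_mono) auto
    moreover have "0 \<le> L * L\<^sub>p / lam0" using L0 Lp0 lam0 by simp
    ultimately show ?thesis by (intro mult_left_mono) simp_all
  qed
  also have "\<dots> = t * L\<^sub>p + BigPi * t"
    by (simp add: assms(19) algebra_simps)
  finally have exponent: "ln (1 / (p - \<delta>)) * (t + ?\<epsilon>) \<le> t * L\<^sub>p + BigPi * t" .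
  have "p powr (- real t) * exp (BigPi * t) = exp (t * L\<^sub>p + BigPi * t)"
    using \<open>0 < p\<close> by (simp add: powr_def Lp ln_div exp_add[symmetric])
  with assms(26)[OF i] have size: "exp (t * L\<^sub>p + BigPi * t) * m \<le> card (Y i)" by simp
  have "real m = exp (- (t * L\<^sub>p + BigPi * t)) * (exp (t * L\<^sub>p + BigPi * t) * m)"
    by (subst exp_minus) simp
  also have "\<dots> \<le> exp (- (t * L\<^sub>p + BigPi * t)) * card (Y i)" using size by (rule mult_left_mono) simp
  also have "\<dots> \<le> exp (- ln (1 / (p - \<delta>)) * (t + ?\<epsilon>)) * card (Y i)"
    using exponent by (intro mult_right_mono) auto
  finally have "real m \<le> card P" using cP by linarith
  then obtain P' where P': "P' \<subseteq> P" "card P' = m"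
    using obtain_subset_with_card_n[of m P] by auto
  have nb: "w \<in> V \<and> w \<noteq> u \<and> c {u, w} = i" if "u \<in> T" "w \<in> P'" for u w
    using P(2) P'(1) that by (auto simp: colour_nbhd_def)
  then have "P' \<inter> T = {}" by blast
  moreover have "P' \<subseteq> V" using P P' assms(24)[OF i] by blast
  ultimately have "P' \<subseteq> Y i - T" "colour_tm_book V c i t m T P'"
    using P(1) P' T nb by (auto simp: colour_tm_book_def colour_book_def)
  with i T P' nb show ?thesis by blast
qed

end
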